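(* Let $\mathbb{k}$ be a field of characteristic zero, let $A,B$ be commutative unital $\mathbb{k}$-algebras, and let $f : A \to B$ be a Frobenius $n$-homomorphism. Regard $\Phi_n(f)$ as a $\mathbb{k}$-linear map $A^{\otimes n} \to B$ and let $\mathcal{S}^nA \subset A^{\otimes n}$ be the subalgebra of symmetric tensors. Then the restriction of $\frac{1}{n!}\Phi_n(f)$ to $\mathcal{S}^nA$ is a ring homomorphism $\mathcal{S}^nA \to B$ (multiplicative and sending $1\otimes\cdots\otimes 1$ to $1$).
   Context: For a $\mathbb{k}$-linear map $f : A \to B$ and $m \ge 1$, define $\Phi_m(f)(a_1,\dots,a_m) = \sum_{\sigma \in \Sigma_m} \epsilon(\sigma) f_\sigma(a_1,\dots,a_m)$, where $\epsilon(\sigma)$ is the sign, and if $\sigma = \gamma_1\cdots\gamma_q$ is the disjoint cycle decomposition (including cycles of length one) then $f_\sigma = \prod_j f_{\gamma_j}$ with $f_\gamma(a_1,\dots,a_m) = f(a_{r_1}\cdots a_{r_j})$ for $\gamma = (r_1\,\dots\,r_j)$. This is symmetric and multilinear, so induces a linear map on $A^{\otimes m}$. $f$ is a Frobenius $n$-homomorphism if $\Phi_{n+1}(f)$ vanishes identically and $f(1) = n\cdot 1_B$. The multiplication on $A^{\otimes n}$ is componentwise. *)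

theory Defs
  imports
    Complex_Main
    "HOL-Library.Poly_Mapping"
    "HOL-Combinatorics.Permutations"
    "HOL-Combinatorics.Orbits"
    "HOL-Algebra.QuotRing"
begin

text \<open>
  The sort \<open>{comm_ring, comm_monoid_mult}\<close> is that of commutative unital rings in which
  \<open>0 = 1\<close> is allowed (unlike \<open>comm_ring_1\<close>), so the zero algebra is included. Since \<open>of_int\<close>
  and \<open>of_nat\<close> need \<open>0 \<noteq> 1\<close>, signs and integer multiples in an algebra are expressed below by
  scalar multiplication.
\<close>

locale comm_algebra = vector_space scale
  for scale :: "'k::field \<Rightarrow> 'a::{comm_ring, comm_monoid_mult} \<Rightarrow> 'a" +
  assumes scale_mult_left: "scale c (x * y) = scale c x * y"

definition type_ring :: "'b::{comm_ring, comm_monoid_mult} ring"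
  where "type_ring = \<lparr>carrier = UNIV, mult = (*), one = 1, zero = 0, add = (+)\<rparr>"


text \<open>
  An \<open>m\<close>-tuple is a list of length \<open>m\<close>, with indices running over \<open>{..<m}\<close>. The cycles
  of \<open>\<sigma>\<close>, including those of length one, are the orbits of \<open>\<sigma>\<close> on \<open>{..<m}\<close>; as the algebra is commutative, the product
  \<open>a\<^sub>r\<^sub>1 \<cdots> a\<^sub>r\<^sub>j\<close> along a cycle depends only on the underlying orbit.
\<close>

definition cycle_product ::
    "('a::comm_monoid_mult \<Rightarrow> 'b::comm_monoid_mult) \<Rightarrow> nat \<Rightarrow> (nat \<Rightarrow> nat) \<Rightarrow> 'a list \<Rightarrow> 'b"
  where "cycle_product f m \<sigma> as = (\<Prod>\<gamma>\<in>orbit \<sigma> ` {..<m}. f (\<Prod>r\<in>\<gamma>. as ! r))"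

definition Phi ::
    "('k::field \<Rightarrow> 'b::{comm_ring, comm_monoid_mult} \<Rightarrow> 'b) \<Rightarrow> nat
      \<Rightarrow> ('a::comm_monoid_mult \<Rightarrow> 'b) \<Rightarrow> 'a list \<Rightarrow> 'b"
  where "Phi sB m f as =
    (\<Sum>\<sigma> | \<sigma> permutes {..<m}. sB (of_int (sign \<sigma>)) (cycle_product f m \<sigma> as))"

definition frobenius_hom ::
    "('k::field \<Rightarrow> 'a::{comm_ring, comm_monoid_mult} \<Rightarrow> 'a)
      \<Rightarrow> ('k \<Rightarrow> 'b::{comm_ring, comm_monoid_mult} \<Rightarrow> 'b) \<Rightarrow> nat \<Rightarrow> ('a \<Rightarrow> 'b) \<Rightarrow> bool"
  where "frobenius_hom sA sB n f \<longleftrightarrow>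
    Vector_Spaces.linear sA sB f \<and>
    (\<forall>as. length as = n + 1 \<longrightarrow> Phi sB (n + 1) f as = 0) \<and>
    f 1 = sB (of_nat n) 1"


definition free_scale :: "'k::field \<Rightarrow> ('x \<Rightarrow>\<^sub>0 'k) \<Rightarrow> ('x \<Rightarrow>\<^sub>0 'k)"
  where "free_scale c p = Poly_Mapping.map ((*) c) p"

lemma lookup_free_scale [simp]: "Poly_Mapping.lookup (free_scale c p) x = c * Poly_Mapping.lookup p x"
  by (simp add: free_scale_def Poly_Mapping.map.rep_eq when_def)

interpretation free: vector_space "free_scale :: 'k::field \<Rightarrow> ('x \<Rightarrow>\<^sub>0 'k) \<Rightarrow> _"
  by unfold_locales (auto intro!: poly_mapping_eqI simp: lookup_add algebra_simps)

definition linear_extension :: "('k::zero \<Rightarrow> 'v::comm_monoid_add \<Rightarrow> 'v) \<Rightarrow> ('x \<Rightarrow> 'v) \<Rightarrow> ('x \<Rightarrow>\<^sub>0 'k) \<Rightarrow> 'v"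
  where "linear_extension s g p = (\<Sum>x\<in>Poly_Mapping.keys p. s (Poly_Mapping.lookup p x) (g x))"

definition free_mult :: "('a::times list \<Rightarrow>\<^sub>0 'k::field) \<Rightarrow> ('a list \<Rightarrow>\<^sub>0 'k) \<Rightarrow> ('a list \<Rightarrow>\<^sub>0 'k)"
  where "free_mult p q =
    (\<Sum>xs\<in>Poly_Mapping.keys p. \<Sum>ys\<in>Poly_Mapping.keys q. Poly_Mapping.single (map2 (*) xs ys) (Poly_Mapping.lookup p xs * Poly_Mapping.lookup q ys))"

definition tuple_algebra :: "nat \<Rightarrow> ('a::{comm_ring, comm_monoid_mult} list \<Rightarrow>\<^sub>0 'k::field) ring"
  where "tuple_algebra n =
    \<lparr>carrier = {p. \<forall>xs\<in>Poly_Mapping.keys p. length xs = n}, mult = free_mult,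
     one = Poly_Mapping.single (replicate n 1) 1, zero = 0, add = (+)\<rparr>"


definition multilinear_relations ::
    "('k::field \<Rightarrow> 'a::{comm_ring, comm_monoid_mult} \<Rightarrow> 'a) \<Rightarrow> nat \<Rightarrow> ('a list \<Rightarrow>\<^sub>0 'k) set"
  where "multilinear_relations s n =
    {Poly_Mapping.single (xs[i := a + b]) 1 - Poly_Mapping.single (xs[i := a]) 1
       - Poly_Mapping.single (xs[i := b]) 1 | xs i a b. length xs = n \<and> i < n} \<union>
    {Poly_Mapping.single (xs[i := s c a]) 1 - free_scale c (Poly_Mapping.single (xs[i := a]) 1)
       | xs i c a. length xs = n \<and> i < n}"

text \<open>
  An element of the \<open>n\<close>-th tensor power is a coset of the span of the multilinear relations in
  the free vector space on \<open>n\<close>-tuples; this span is an ideal for the multiplication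
  \<open>free_mult\<close> that is componentwise on tuples.
\<close>

definition tensor_power ::
    "('k::field \<Rightarrow> 'a::{comm_ring, comm_monoid_mult} \<Rightarrow> 'a) \<Rightarrow> nat \<Rightarrow> ('a list \<Rightarrow>\<^sub>0 'k) set ring"
  where "tensor_power s n = tuple_algebra n Quot free.span (multilinear_relations s n)"

definition permute_tensor ::
    "(nat \<Rightarrow> nat) \<Rightarrow> ('a list \<Rightarrow>\<^sub>0 'k::field) set \<Rightarrow> ('a list \<Rightarrow>\<^sub>0 'k) set"
  where "permute_tensor \<sigma> t =
    linear_extension free_scale (\<lambda>xs. Poly_Mapping.single (permute_list \<sigma> xs) 1) ` t"

definition symmetric_tensors ::
    "('k::field \<Rightarrow> 'a::{comm_ring, comm_monoid_mult} \<Rightarrow> 'a) \<Rightarrow> nat \<Rightarrow> ('a list \<Rightarrow>\<^sub>0 'k) set ring"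
  where "symmetric_tensors s n = (tensor_power s n)
    \<lparr>carrier := {t \<in> carrier (tensor_power s n). \<forall>\<sigma>. \<sigma> permutes {..<n} \<longrightarrow> permute_tensor \<sigma> t = t}\<rparr>"

text \<open>
  The linear map on the tensor power induced by a multilinear map \<open>g\<close>: the linear extension of
  \<open>g\<close> is constant on each coset, and the induced map takes that common value.
\<close>

definition induced_map :: "('k::zero \<Rightarrow> 'v::comm_monoid_add \<Rightarrow> 'v) \<Rightarrow> ('x \<Rightarrow> 'v) \<Rightarrow> ('x \<Rightarrow>\<^sub>0 'k) set \<Rightarrow> 'v"
  where "induced_map s g t = the_elem (linear_extension s g ` t)"

end

theory Submission
  imports Defs "HOL-Combinatorics.Multiset_Permutations" "HOL-Algebra.Subrings"
begin

text \<open>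
  Splitting off the cycle through the last argument gives the recursion
  \<open>\<Phi>\<^sub>m\<^sub>+\<^sub>1(a, a\<^sub>1, \<dots>, a\<^sub>m) = f(a) \<Phi>\<^sub>m(a\<^sub>1, \<dots>, a\<^sub>m) - \<Sum>\<^sub>i \<Phi>\<^sub>m(a\<^sub>1, \<dots>, a a\<^sub>i, \<dots>, a\<^sub>m)\<close>. It implies, for every
  map \<open>f\<close>, that \<open>\<Phi>\<^sub>k(a\<^sub>1, \<dots>, a\<^sub>k) \<Phi>\<^sub>l(b\<^sub>1, \<dots>, b\<^sub>l)\<close> is the sum over all partial matchings between the
  \<open>a\<^sub>i\<close> and the \<open>b\<^sub>j\<close> of the value of \<open>\<Phi>\<close> on the tuple in which matched entries are multiplied and
  unmatched entries are kept. A Frobenius \<open>n\<close>-homomorphism has \<open>\<Phi>\<^sub>m = 0\<close> for all \<open>m > n\<close>, so for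
  \<open>k = l = n\<close> only the perfect matchings contribute:
  \<open>\<Phi>\<^sub>n(t) \<Phi>\<^sub>n(u) = \<Sum>\<^sub>\<sigma> \<Phi>\<^sub>n(t \<cdot> \<sigma>u)\<close> for all tensors \<open>t\<close>, \<open>u\<close>, which is \<open>n! \<Phi>\<^sub>n(t u)\<close> if \<open>u\<close> is symmetric.
\<close>

section \<open>Partial matchings\<close>

text \<open>The subtracted term of the recursion. Arguments form a multiset because
  \<open>Phi\<close> is symmetric; equal entries count with multiplicity.\<close>

definition mult_derivation ::
    "'a::times \<Rightarrow> ('a multiset \<Rightarrow> 'b::comm_monoid_add) \<Rightarrow> 'a multiset \<Rightarrow> 'b"
  where "mult_derivation a F M = (\<Sum>c\<in>#M. F (add_mset (a * c) (M - {#c#})))"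

lemma mult_derivation_empty [simp]: "mult_derivation a F {#} = 0"
  by (simp add: mult_derivation_def)

text \<open>A Leibniz rule: the factor \<open>a\<close> hits either the new entry or one of the old
  ones.\<close>

lemma mult_derivation_add_mset:
  "mult_derivation a F (add_mset c M) =
     F (add_mset (a * c) M) + mult_derivation a (\<lambda>N. F (add_mset c N)) M"
proof -
  \<comment> \<open>Here \<open>x\<close> ranges over entries of \<open>M\<close>, so one copy of
    \<open>x\<close> can be removed from \<open>M\<close> itself, even if
    \<open>x = c\<close>.\<close>
  have "image_mset (\<lambda>x. F (add_mset (a * x) (add_mset c M - {#x#}))) M =
      image_mset (\<lambda>x. F (add_mset c (add_mset (a * x) (M - {#x#})))) M"
    by (rule image_mset_cong) (simp add: add_mset_commute)
  then show ?thesis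
    by (simp add: mult_derivation_def)
qed

lemma mult_derivation_mset:
  "mult_derivation a F (mset as) = (\<Sum>i<length as. F (mset (as[i := a * as ! i])))"
proof (induction as arbitrary: F)
  case (Cons c as)
  have "{..<Suc (length as)} = insert 0 (Suc ` {..<length as})"
    by (auto simp: lessThan_Suc_eq_insert_0)
  then show ?case
    by (simp add: mult_derivation_add_mset Cons.IH sum.reindex o_def)
qed simp

lemma mult_derivation_image_mset_set:
  assumes "finite J"
  shows "mult_derivation a F (image_mset b (mset_set J)) =
    (\<Sum>j\<in>J. F (add_mset (a * b j) (image_mset b (mset_set (J - {j})))))"
proof -
  have "(\<Sum>j\<in>J. F (add_mset (a * b j) (image_mset b (mset_set J) - {#b j#}))) =
      (\<Sum>j\<in>J. F (add_mset (a * b j) (image_mset b (mset_set (J - {j})))))"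
    using assms by (intro sum.cong) (simp_all add: mset_set_Diff image_mset_Diff)
  then show ?thesis
    by (simp add: mult_derivation_def sum_unfold_sum_mset multiset.map_comp o_def)
qed

text \<open>
  The sum of \<open>F\<close> over all partial matchings between the entries of \<open>as\<close> and the family \<open>b\<close> on \<open>J\<close>:
  matched entries are multiplied, unmatched ones are kept.
\<close>

fun matching_sum ::
    "('a::times multiset \<Rightarrow> 'b::comm_monoid_add) \<Rightarrow> (nat \<Rightarrow> 'a) \<Rightarrow> 'a list \<Rightarrow> nat set \<Rightarrow> 'b"
  where
    "matching_sum F b [] J = F (image_mset b (mset_set J))"
  | "matching_sum F b (a # as) J = matching_sum (\<lambda>M. F (add_mset a M)) b as J +
      (\<Sum>j\<in>J. matching_sum (\<lambda>M. F (add_mset (a * b j) M)) b as (J - {j}))"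

lemma matching_sum_add:
  "matching_sum (\<lambda>M. F M + G M) b as J = matching_sum F b as J + matching_sum G b as J"
  by (induction as arbitrary: F G J) (simp_all add: sum.distrib algebra_simps)

lemma matching_sum_diff:
  fixes F G :: "'a::times multiset \<Rightarrow> 'b::ab_group_add"
  shows "matching_sum (\<lambda>M. F M - G M) b as J = matching_sum F b as J - matching_sum G b as J"
  by (induction as arbitrary: F G J) (simp_all add: sum_subtractf add_diff_add)

lemma matching_sum_mult_left:
  fixes F :: "'a::times multiset \<Rightarrow> 'b::semiring_0"
  shows "matching_sum (\<lambda>M. c * F M) b as J = c * matching_sum F b as J"
  by (induction as arbitrary: F J) (simp_all add: sum_distrib_left distrib_left)

text \<open>Ordered pairs of distinct indices are stable under exchange of coordinates. This lets
  two entries trade their partners.\<close>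

lemma sum_remove_swap:
  assumes "finite J"
  shows "(\<Sum>j\<in>J. \<Sum>k\<in>J - {j}. g j k) = (\<Sum>j\<in>J. \<Sum>k\<in>J - {j}. g k j)"
proof -
  have "J - {j} = {k \<in> J. k \<noteq> j}" for j
    by auto
  moreover have "{k \<in> J. k \<noteq> j} = {k \<in> J. j \<noteq> k}" for j
    by auto
  ultimately show ?thesis
    using sum.swap_restrict[OF assms assms, of g "\<lambda>j k. k \<noteq> j"] by simp
qed

text \<open>
  Every entry of a matched tuple contains either an entry of \<open>as\<close> or an unmatched \<open>b j\<close>, so the
  derivation can be carried out before matching.
\<close>

lemma matching_sum_mult_derivation:
  fixes F :: "'a::ab_semigroup_mult multiset \<Rightarrow> 'b::comm_monoid_add"
  assumes "finite J"
  shows "matching_sum (mult_derivation a F) b as J =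
    (\<Sum>i<length as. matching_sum F b (as[i := a * as ! i]) J) +
    (\<Sum>j\<in>J. matching_sum (\<lambda>M. F (add_mset (a * b j) M)) b as (J - {j}))"
  using assms
proof (induction as arbitrary: F J)
  case Nil
  then show ?case
    by (simp add: mult_derivation_image_mset_set)
next
  case (Cons c as)
  let ?S = "\<lambda>G. matching_sum G b"
  have split: "(\<Sum>i<length (c # as). ?S F ((c # as)[i := a * (c # as) ! i]) J) =
      ?S F (a * c # as) J + (\<Sum>i<length as. ?S F (c # as[i := a * as ! i]) J)"
  proof -
    have "{..<Suc (length as)} = insert 0 (Suc ` {..<length as})"
      by (auto simp: lessThan_Suc_eq_insert_0)
    then show ?thesis
      by (simp add: sum.reindex o_def del: matching_sum.simps)
  qed
  \<comment> \<open>When \<open>c\<close> is matched and \<open>a\<close> goes to a further index,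
    the two sides of the claim name these indices in opposite order.\<close>
  have swap: "(\<Sum>j\<in>J. \<Sum>k\<in>J - {j}. ?S (\<lambda>M. F (add_mset (c * b j) (add_mset (a * b k) M))) as (J - {j} - {k})) =
      (\<Sum>j\<in>J. \<Sum>k\<in>J - {j}. ?S (\<lambda>M. F (add_mset (a * b j) (add_mset (c * b k) M))) as (J - {j} - {k}))"
    using sum_remove_swap[OF Cons.prems, of "\<lambda>j k. ?S (\<lambda>M. F (add_mset (c * b j) (add_mset (a * b k) M))) as (J - {j} - {k})"]
    by (simp add: add_mset_commute Diff_insert2[symmetric] insert_commute)
  have IH2: "(\<Sum>j\<in>J. ?S (mult_derivation a (\<lambda>M. F (add_mset (c * b j) M))) as (J - {j})) =
     (\<Sum>j\<in>J. \<Sum>i<length as. ?S (\<lambda>M. F (add_mset (c * b j) M)) (as[i := a * as ! i]) (J - {j})) +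
     (\<Sum>j\<in>J. \<Sum>k\<in>J - {j}. ?S (\<lambda>M. F (add_mset (c * b j) (add_mset (a * b k) M))) as (J - {j} - {k}))"
    using Cons.prems by (simp add: Cons.IH sum.distrib)
  have IH1: "?S (mult_derivation a (\<lambda>M. F (add_mset c M))) as J =
     (\<Sum>i<length as. ?S (\<lambda>M. F (add_mset c M)) (as[i := a * as ! i]) J) +
     (\<Sum>j\<in>J. ?S (\<lambda>M. F (add_mset (a * b j) (add_mset c M))) as (J - {j}))"
    using Cons.prems by (simp add: Cons.IH add_mset_commute)
  have rhs: "(\<Sum>i<length as. ?S F (c # as[i := a * as ! i]) J) =
     (\<Sum>i<length as. ?S (\<lambda>M. F (add_mset c M)) (as[i := a * as ! i]) J) +
     (\<Sum>j\<in>J. \<Sum>i<length as. ?S (\<lambda>M. F (add_mset (c * b j) M)) (as[i := a * as ! i]) (J - {j}))"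
    by (simp add: sum.distrib sum.swap[of _ "{..<length as}" J])
  \<comment> \<open>Hitting the kept entry \<open>c\<close> gives \<open>a * c\<close>, and hitting
    the matched entry \<open>c * b j\<close> gives \<open>(a * c) * b j\<close>; together these form
    the matching sum that starts with \<open>a * c\<close>.\<close>
  have lhs: "?S (mult_derivation a F) (c # as) J = ?S F (a * c # as) J +
     ?S (mult_derivation a (\<lambda>M. F (add_mset c M))) as J +
     (\<Sum>j\<in>J. ?S (mult_derivation a (\<lambda>M. F (add_mset (c * b j) M))) as (J - {j}))"
    by (simp add: mult_derivation_add_mset matching_sum_add sum.distrib mult.assoc add_ac)
  show ?case
    unfolding split lhs rhs IH1 IH2 swap by (simp add: sum.distrib add_ac)
qed

text \<open>The recursion, applied to the first factor of the product and to the unmatched first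
  entry of the matching sum, yields the same expression on both sides. The premise
  \<open>empty\<close> makes \<open>F {#}\<close> a unit without assuming a \<open>1\<close> in the
  sort.\<close>

lemma product_eq_matching_sum:
  fixes F :: "'a::ab_semigroup_mult multiset \<Rightarrow> 'b::comm_ring"
    and f :: "'a \<Rightarrow> 'b"
  assumes empty: "\<And>x. F {#} * x = x"
    and rec: "\<And>a M. F (add_mset a M) = f a * F M - mult_derivation a F M"
    and "finite J"
  shows "F (mset as) * F (image_mset b (mset_set J)) = matching_sum F b as J"
\<comment> \<open>The hypothesis is also needed for tails with one entry multiplied by
  \<open>a\<close>, hence induction on the length.\<close>
proof (induction "length as" arbitrary: as)
  case 0
  then show ?case by (simp add: empty)
next
  case (Suc k)
  then obtain a as' where as: "as = a # as'" and k: "length as' = k"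
    by (cases as) auto
  have "F (mset as) * F (image_mset b (mset_set J)) =
      f a * (F (mset as') * F (image_mset b (mset_set J))) -
      (\<Sum>i<k. F (mset (as'[i := a * as' ! i])) * F (image_mset b (mset_set J)))"
    by (simp add: as rec mult_derivation_mset left_diff_distrib sum_distrib_right mult.assoc k)
  also have "\<dots> = f a * matching_sum F b as' J -
      (\<Sum>i<k. matching_sum F b (as'[i := a * as' ! i]) J)"
    by (simp add: Suc.hyps(1) k)
  \<comment> \<open>Expanding an unmatched \<open>a\<close> by \<open>rec\<close> subtracts a
    derivation; its part with \<open>a\<close> multiplied into some \<open>b j\<close> cancels the
    terms in which \<open>a\<close> is matched.\<close>
  also have "\<dots> = matching_sum F b as J"
    using matching_sum_mult_derivation[OF assms(3), of a F b as']
    by (simp add: as rec matching_sum_diff matching_sum_mult_left k)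
  finally show ?case .
qed

section \<open>Perfect matchings and permutations\<close>

text \<open>Different indices of \<open>J\<close> always end up in different entries, so every
  matched tuple has at least \<open>card J\<close> entries.\<close>

lemma matching_sum_eq_0:
  assumes "\<And>M. size M \<ge> card J \<Longrightarrow> F M = 0" "finite J"
  shows "matching_sum F b as J = 0"
  using assms
proof (induction as arbitrary: F J)
  case (Cons a as)
  have "matching_sum (\<lambda>M. F (add_mset (a * b j) M)) b as (J - {j}) = 0" if "j \<in> J" for j
    using that Cons.prems by (intro Cons.IH) auto
  moreover have "matching_sum (\<lambda>M. F (add_mset a M)) b as J = 0"
    using Cons.prems by (intro Cons.IH) auto
  ultimately show ?case by simp
qed simp

lemma sum_permutations_of_set_nonempty:
  assumes "finite J" "J \<noteq> {}"
  shows "sum g (permutations_of_set J) = (\<Sum>j\<in>J. \<Sum>xs\<in>permutations_of_set (J - {j}). g (j # xs))"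
proof -
  have "sum g (permutations_of_set J) =
      (\<Sum>j\<in>J. sum g ((#) j ` permutations_of_set (J - {j})))"
    unfolding permutations_of_set_nonempty[OF assms(2)]
    using assms by (intro sum.UNION_disjoint) auto
  then show ?thesis
    by (simp add: sum.reindex)
qed

text \<open>If the first entry stays unmatched, the tuple has more than \<open>card J\<close>
  entries and its term vanishes. So each entry of \<open>as\<close> takes a partner, which amounts
  to an ordering of \<open>J\<close>.\<close>

lemma matching_sum_perfect:
  assumes "\<And>M. size M > length as \<Longrightarrow> F M = 0" "finite J" "card J = length as"
  shows "matching_sum F b as J = (\<Sum>xs\<in>permutations_of_set J. F (mset (map2 (*) as (map b xs))))"
  using assms
proof (induction as arbitrary: F J)
  case (Cons a as)
  have "matching_sum (\<lambda>M. F (add_mset a M)) b as J = 0"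
    using Cons.prems by (intro matching_sum_eq_0) auto
  moreover have "J \<noteq> {}"
    using Cons.prems by auto
  moreover have "matching_sum (\<lambda>M. F (add_mset (a * b j) M)) b as (J - {j}) =
      (\<Sum>xs\<in>permutations_of_set (J - {j}). F (mset (map2 (*) (a # as) (map b (j # xs)))))" if "j \<in> J" for j
    using that Cons.prems by (subst Cons.IH) auto
  ultimately show ?case
    using Cons.prems(2) by (simp add: sum_permutations_of_set_nonempty del: map_map)
qed simp

lemma bij_betw_permutes_permutations_of_set:
  "bij_betw (\<lambda>\<sigma>. map \<sigma> [0..<n]) {\<sigma>. \<sigma> permutes {..<n}} (permutations_of_set {..<n})"
proof -
  have inj: "inj_on (\<lambda>\<sigma>. map \<sigma> [0..<n]) {\<sigma>. \<sigma> permutes {..<n}}"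
  proof (rule inj_onI, rule ext)
    fix \<sigma> \<tau> :: "nat \<Rightarrow> nat" and x
    assume "\<sigma> \<in> {\<sigma>. \<sigma> permutes {..<n}}" "\<tau> \<in> {\<sigma>. \<sigma> permutes {..<n}}"
      and "map \<sigma> [0..<n] = map \<tau> [0..<n]"
    then show "\<sigma> x = \<tau> x"
      by (cases "x < n") (auto simp: permutes_def)
  qed
  have "(\<lambda>\<sigma>. map \<sigma> [0..<n]) ` {\<sigma>. \<sigma> permutes {..<n}} \<subseteq> permutations_of_set {..<n}"
    by (auto simp: permutations_of_set_def distinct_map permutes_image[unfolded lessThan_atLeast0]
        lessThan_atLeast0 intro: permutes_inj_on)
  \<comment> \<open>Both sides have \<open>fact n\<close> elements, so the injection is
    onto.\<close>
  moreover have "card ((\<lambda>\<sigma>. map \<sigma> [0..<n]) ` {\<sigma>. \<sigma> permutes {..<n}}) = card (permutations_of_set {..<n})"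
    by (simp add: card_image[OF inj] card_permutations)
  ultimately show ?thesis
    using inj by (simp add: bij_betw_def card_subset_eq)
qed

lemma product_eq_sum_permutations:
  fixes F :: "'a::ab_semigroup_mult multiset \<Rightarrow> 'b::comm_ring"
    and f :: "'a \<Rightarrow> 'b"
  assumes "\<And>x. F {#} * x = x"
    and "\<And>a M. F (add_mset a M) = f a * F M - mult_derivation a F M"
    and "\<And>M. size M > n \<Longrightarrow> F M = 0"
    and "length as = n" "length bs = n"
  shows "F (mset as) * F (mset bs) =
    (\<Sum>\<sigma> | \<sigma> permutes {..<n}. F (mset (map2 (*) as (permute_list \<sigma> bs))))"
proof -
  have "mset bs = image_mset ((!) bs) (mset_set {..<n})"
    by (metis assms(5) lessThan_atLeast0 map_nth mset_map mset_upt)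
  then have "F (mset as) * F (mset bs) = matching_sum F ((!) bs) as {..<n}"
    using product_eq_matching_sum[of F f "{..<n}"] assms by simp
  also have "\<dots> = (\<Sum>xs\<in>permutations_of_set {..<n}. F (mset (map2 (*) as (map ((!) bs) xs))))"
    using assms by (intro matching_sum_perfect) auto
  also have "\<dots> = (\<Sum>\<sigma> | \<sigma> permutes {..<n}. F (mset (map2 (*) as (map ((!) bs) (map \<sigma> [0..<n])))))"
    by (rule sum.reindex_bij_betw[OF bij_betw_permutes_permutations_of_set, symmetric])
  also have "\<dots> = (\<Sum>\<sigma> | \<sigma> permutes {..<n}. F (mset (map2 (*) as (permute_list \<sigma> bs))))"
    by (simp add: permute_list_def assms(5) o_def)
  finally show ?thesis .
qed

section \<open>The recursion for Phi\<close>

text \<open>The inductive set \<open>orbit p x\<close> starts from \<open>p x\<close>, not from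
  \<open>x\<close>, hence the form of the first premise.\<close>

lemma orbit_subsetI:
  assumes "p x \<in> C" "\<And>y. y \<in> C \<Longrightarrow> p y \<in> C"
  shows "orbit p x \<subseteq> C"
proof
  fix y assume "y \<in> orbit p x"
  then show "y \<in> C" by induct (use assms in auto)
qed

lemma orbit_conjugate:
  assumes "bij \<pi>"
  shows "orbit (\<pi> \<circ> \<sigma> \<circ> Hilbert_Choice.inv \<pi>) (\<pi> x) = \<pi> ` orbit \<sigma> x"
proof
  note [simp] = bij_is_inj[OF assms]
  show "orbit (\<pi> \<circ> \<sigma> \<circ> Hilbert_Choice.inv \<pi>) (\<pi> x) \<subseteq> \<pi> ` orbit \<sigma> x"
    by (rule orbit_subsetI) (auto intro: orbit.intros)
  have "\<pi> y \<in> orbit (\<pi> \<circ> \<sigma> \<circ> Hilbert_Choice.inv \<pi>) (\<pi> x)" if "y \<in> orbit \<sigma> x" for y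
    using that
  proof induct
    case base
    show ?case by (rule orbit_eqI(1)) simp
  next
    case (step y)
    show ?case by (rule orbit_eqI(2)[OF _ step(2)]) simp
  qed
  then show "\<pi> ` orbit \<sigma> x \<subseteq> orbit (\<pi> \<circ> \<sigma> \<circ> Hilbert_Choice.inv \<pi>) (\<pi> x)"
    by auto
qed

lemma orbit_eq_if_mem:
  assumes "\<sigma> permutes S" "finite S" "y \<in> orbit \<sigma> x"
  shows "orbit \<sigma> y = orbit \<sigma> x"
  using assms by (meson cyclic_on_orbit orbit_cyclic_eq3)

lemma self_in_orbit:
  assumes "\<sigma> permutes S" "finite S"
  shows "x \<in> orbit \<sigma> x"
  using assms by (metis permutation_permutes permutation_self_in_orbit)

context
  fixes q :: "'a \<Rightarrow> 'a" and S i a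
  assumes q: "q permutes S" and S: "finite S" "i \<in> S" "a \<notin> S"
begin

lemma transpose_comp_permutes: "transpose a i \<circ> q permutes insert a S"
  using q S by (intro permutes_compose permutes_swap_id permutes_subset[OF q]) auto

text \<open>The composite sends the \<open>q\<close>-preimage of \<open>i\<close> to
  \<open>a\<close> and \<open>a\<close> to \<open>i\<close>. It thus splices \<open>a\<close> into
  the cycle of \<open>i\<close>, just before \<open>i\<close>, and leaves the other cycles
  alone.\<close>

lemma orbit_transpose_comp:
  assumes "x \<in> S"
  shows "orbit (transpose a i \<circ> q) x =
    (if i \<in> orbit q x then insert a (orbit q x) else orbit q x)"
proof -
  define s where "s = transpose a i \<circ> q"
  have S_neq: "y \<noteq> a" if "y \<in> S" for y
    using that S by auto
  have sa: "s a = i"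
    using q S by (simp add: s_def permutes_not_in)
  have s: "s y = (if q y = i then a else q y)" if "y \<in> S" for y
    using S_neq[of "q y"] that by (simp add: s_def transpose_def permutes_in_image[OF q])
  have in_S: "y \<in> S" if "y \<in> orbit q x" for y
    using permutes_orbit_subset[OF q assms] that by auto
  \<comment> \<open>One step of \<open>q\<close> is one step of \<open>s\<close>, or two steps
    through \<open>a\<close> if it arrives at \<open>i\<close>.\<close>
  have step: "q y \<in> orbit s x" if "s y \<in> orbit s x" "y \<in> S" for y
  proof (cases "q y = i")
    case True
    then have "a \<in> orbit s x"
      using that s by simp
    then show ?thesis
      using orbit.step[of a s x] sa True by simp
  next
    case False
    then show ?thesis using that s by simp
  qed
  have sub: "y \<in> orbit s x" if "y \<in> orbit q x" for y
    using that
  proof induct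
    case base
    show ?case by (rule step[OF orbit.base assms])
  next
    case (step y)
    show ?case by (rule \<open>\<And>y. s y \<in> orbit s x \<Longrightarrow> y \<in> S \<Longrightarrow> q y \<in> orbit s x\<close>
          [OF orbit.step[OF step(2)] in_S[OF step(1)]])
  qed
  have mem_a: "a \<in> orbit s x" if "i \<in> orbit q x"
    using that
  proof cases
    case base
    then show ?thesis using orbit.base[of s x] s[OF assms] by simp
  next
    case (step y)
    then show ?thesis using orbit.step[OF sub[OF step(2)]] s[OF in_S[OF step(2)]] by simp
  qed
  show ?thesis
  proof (cases "i \<in> orbit q x")
    case True
    have "orbit s x \<subseteq> insert a (orbit q x)"
    proof (rule orbit_subsetI)
      show "s x \<in> insert a (orbit q x)"
        using s[OF assms] orbit.base[of q x] by simp
      show "s y \<in> insert a (orbit q x)" if "y \<in> insert a (orbit q x)" for y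
        using that True sa s[OF in_S, of y] orbit.step[of y q x] by (cases "y = a") auto
    qed
    then show ?thesis
      using True sub mem_a unfolding s_def by auto
  next
    case False
    have "orbit s x \<subseteq> orbit q x"
    proof (rule orbit_subsetI)
      have "q x \<noteq> i"
        using False orbit.base[of q x] by auto
      then show "s x \<in> orbit q x"
        using s[OF assms] orbit.base[of q x] by simp
      show "s y \<in> orbit q x" if "y \<in> orbit q x" for y
      proof -
        have "q y \<in> orbit q x"
          by (rule orbit.step[OF that])
        moreover have "q y \<noteq> i"
          using False calculation by auto
        ultimately show ?thesis
          using s[OF in_S[OF that]] by simp
      qed
    qed
    then show ?thesis
      using False sub unfolding s_def by auto
  qed
qed

lemma orbits_transpose_comp:
  "orbit (transpose a i \<circ> q) ` insert a S =
     insert (insert a (orbit q i)) (orbit q ` S - {orbit q i})"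
proof -
  define s where "s = transpose a i \<circ> q"
  have s: "s permutes insert a S"
    unfolding s_def by (rule transpose_comp_permutes)
  have i: "i \<in> orbit q i"
    by (rule self_in_orbit[OF q S(1)])
  have oi: "orbit s i = insert a (orbit q i)"
    using i orbit_transpose_comp[OF S(2)] by (simp only: s_def if_True)
  \<comment> \<open>The preceding lemma only treats starting points in \<open>S\<close>; the point
    \<open>a\<close> is reached through the orbit of \<open>i\<close>.\<close>
  have "orbit s a = orbit s i"
    by (rule orbit_eq_if_mem[OF s]) (use S oi in auto)
  then have "orbit s ` insert a S = insert (insert a (orbit q i)) (orbit s ` S)"
    using oi by simp
  also have "orbit s ` S = insert (insert a (orbit q i)) (orbit q ` S - {orbit q i})"
  proof -
    have in_i: "orbit s x = insert a (orbit q i)" if "x \<in> S" "orbit q x = orbit q i" for x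
      using orbit_transpose_comp[OF that(1)] i that(2) by (simp only: s_def if_True)
    have not_i: "orbit s x = orbit q x" if "x \<in> S" "orbit q x \<noteq> orbit q i" for x
    proof -
      have "i \<notin> orbit q x"
        using orbit_eq_if_mem[OF q S(1), of i x] that(2) by metis
      then show ?thesis
        using orbit_transpose_comp[OF that(1)] by (simp only: s_def if_False)
    qed
    have "S = {x \<in> S. orbit q x = orbit q i} \<union> {x \<in> S. orbit q x \<noteq> orbit q i}"
      by blast
    then have "orbit s ` S = orbit s ` {x \<in> S. orbit q x = orbit q i} \<union> orbit s ` {x \<in> S. orbit q x \<noteq> orbit q i}"
      by (metis image_Un)
    also have "orbit s ` {x \<in> S. orbit q x = orbit q i} = {insert a (orbit q i)}"
      using in_i S(2) by (auto simp: image_iff)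
    also have "orbit s ` {x \<in> S. orbit q x \<noteq> orbit q i} = orbit q ` {x \<in> S. orbit q x \<noteq> orbit q i}"
      by (rule image_cong) (use not_i in auto)
    also have "\<dots> = orbit q ` S - {orbit q i}"
      by blast
    finally show ?thesis by simp
  qed
  finally show ?thesis
    by (simp only: s_def insert_absorb2)
qed

end

section \<open>Cycle products under changes of the argument list\<close>

lemma cycle_product_split:
  assumes "\<sigma> permutes {..<m}" "i < m"
  shows "cycle_product f m \<sigma> as =
    f (\<Prod>r\<in>orbit \<sigma> i. as ! r) * (\<Prod>\<gamma>\<in>orbit \<sigma> ` {..<m} - {orbit \<sigma> i}. f (\<Prod>r\<in>\<gamma>. as ! r))"
  unfolding cycle_product_def using assms by (intro prod.remove) auto

text \<open>Distinct cycles are disjoint, so the entry at \<open>i\<close> occurs in the argument of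
  exactly one \<open>f\<close>. Both multilinearity and the recursion use this form.\<close>

lemma cycle_product_update:
  assumes "\<sigma> permutes {..<m}" "i < m" "length as = m"
  shows "cycle_product f m \<sigma> (as[i := x]) =
    f (x * (\<Prod>r\<in>orbit \<sigma> i - {i}. as ! r)) *
    (\<Prod>\<gamma>\<in>orbit \<sigma> ` {..<m} - {orbit \<sigma> i}. f (\<Prod>r\<in>\<gamma>. as ! r))"
proof -
  have i: "i \<in> orbit \<sigma> i"
    using self_in_orbit[OF assms(1)] by auto
  then have fin: "finite (orbit \<sigma> i)"
    by (rule finite_orbit)
  have "(\<Prod>r\<in>orbit \<sigma> i. as[i := x] ! r) = x * (\<Prod>r\<in>orbit \<sigma> i - {i}. as ! r)"
    using assms by (subst prod.remove[OF fin i]) simp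
  moreover have "(\<Prod>r\<in>\<gamma>. as[i := x] ! r) = (\<Prod>r\<in>\<gamma>. as ! r)"
    if "\<gamma> \<in> orbit \<sigma> ` {..<m} - {orbit \<sigma> i}" for \<gamma>
  proof (rule prod.cong)
    fix r assume "r \<in> \<gamma>"
    then have "r \<noteq> i"
      using that orbit_eq_if_mem[OF assms(1), of i] by auto
    then show "as[i := x] ! r = as ! r" by simp
  qed simp
  ultimately show ?thesis
    using assms by (simp add: cycle_product_split)
qed

lemma cycle_product_snoc_fixed:
  assumes "q permutes {..<m}" "length as = m"
  shows "cycle_product f (Suc m) q (as @ [a]) = f a * cycle_product f m q as"
proof -
  have "q m = m"
    using assms by (simp add: permutes_def)
  then have orb: "orbit q m = {m}"
    by (simp add: orbit_eq_singleton_iff)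
  have sub: "\<gamma> \<subseteq> {..<m}" if "\<gamma> \<in> orbit q ` {..<m}" for \<gamma>
    using that permutes_orbit_subset[OF assms(1)] by auto
  then have "{m} \<notin> orbit q ` {..<m}"
    by blast
  moreover have "(\<Prod>r\<in>\<gamma>. (as @ [a]) ! r) = (\<Prod>r\<in>\<gamma>. as ! r)" if "\<gamma> \<in> orbit q ` {..<m}" for \<gamma>
    using sub[OF that] assms by (intro prod.cong) (auto simp: nth_append)
  ultimately show ?thesis
    using assms by (simp add: cycle_product_def lessThan_Suc orb nth_append)
qed

text \<open>As \<open>m\<close> joins the cycle of \<open>i\<close>, the last argument
  \<open>a\<close> occurs only in a product with \<open>as ! i\<close>, so it can be absorbed into
  that entry.\<close>

lemma cycle_product_snoc_transpose:
  assumes "q permutes {..<m}" "i < m" "length as = m"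
  shows "cycle_product f (Suc m) (transpose m i \<circ> q) (as @ [a]) =
    cycle_product f m q (as[i := as ! i * a])"
proof -
  have sub: "\<gamma> \<subseteq> {..<m}" if "\<gamma> \<in> orbit q ` {..<m}" for \<gamma>
    using that permutes_orbit_subset[OF assms(1)] by auto
  have eq: "(\<Prod>r\<in>\<gamma>. (as @ [a]) ! r) = (\<Prod>r\<in>\<gamma>. as ! r)" if "\<gamma> \<in> orbit q ` {..<m}" for \<gamma>
    using sub[OF that] assms by (intro prod.cong) (auto simp: nth_append)
  let ?C = "orbit q i"
  have i: "i \<in> ?C"
    using self_in_orbit[OF assms(1)] by auto
  then have fin: "finite ?C"
    by (rule finite_orbit)
  have C: "?C \<in> orbit q ` {..<m}"
    using assms by auto
  have m: "m \<notin> ?C"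
    using sub[OF C] by auto
  have "(\<Prod>r\<in>insert m ?C. (as @ [a]) ! r) = a * (\<Prod>r\<in>?C. as ! r)"
    using fin m eq[OF C] assms by (simp add: nth_append)
  also have "\<dots> = (as ! i * a) * (\<Prod>r\<in>?C - {i}. as ! r)"
    using prod.remove[OF fin i, of "(!) as"] by (simp add: ac_simps)
  finally have 1: "(\<Prod>r\<in>insert m ?C. (as @ [a]) ! r) = \<dots>" .
  \<comment> \<open>The remaining cycles lie in \<open>{..<m}\<close>, so the enlarged one is not
    among them and its factor can be split off.\<close>
  have "insert m ?C \<notin> orbit q ` {..<m} - {?C}"
    using sub by blast
  moreover have "orbit (transpose m i \<circ> q) ` {..<Suc m} =
      insert (insert m ?C) (orbit q ` {..<m} - {?C})"
    using orbits_transpose_comp[OF assms(1), of i m] assms by (simp add: lessThan_Suc)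
  moreover have "(\<Prod>\<gamma>\<in>orbit q ` {..<m} - {?C}. f (\<Prod>r\<in>\<gamma>. (as @ [a]) ! r)) =
      (\<Prod>\<gamma>\<in>orbit q ` {..<m} - {?C}. f (\<Prod>r\<in>\<gamma>. as ! r))"
    by (intro prod.cong) (simp_all add: eq)
  ultimately have "cycle_product f (Suc m) (transpose m i \<circ> q) (as @ [a]) =
     f ((as ! i * a) * (\<Prod>r\<in>?C - {i}. as ! r)) *
     (\<Prod>\<gamma>\<in>orbit q ` {..<m} - {?C}. f (\<Prod>r\<in>\<gamma>. as ! r))"
    by (simp only: cycle_product_def prod.insert finite_Diff finite_imageI finite_lessThan 1 simp_thms)
  then show ?thesis
    using assms by (simp add: cycle_product_update)
qed

text \<open>The map \<open>\<pi>\<close> carries the cycles of \<open>\<sigma>\<close> to those of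
  its conjugate, and \<open>permute_list\<close> reads the entry at \<open>\<pi> r\<close>.\<close>

lemma cycle_product_permute_list:
  assumes "\<pi> permutes {..<m}" "length as = m" "\<sigma> permutes {..<m}"
  shows "cycle_product f m \<sigma> (permute_list \<pi> as) = cycle_product f m (\<pi> \<circ> \<sigma> \<circ> Hilbert_Choice.inv \<pi>) as"
proof -
  note bij = permutes_bij[OF assms(1)] and inj = permutes_inj[OF assms(1)]
  have "orbit (\<pi> \<circ> \<sigma> \<circ> Hilbert_Choice.inv \<pi>) ` {..<m} = orbit (\<pi> \<circ> \<sigma> \<circ> Hilbert_Choice.inv \<pi>) ` \<pi> ` {..<m}"
    by (simp add: permutes_image[OF assms(1)])
  also have "\<dots> = (`) \<pi> ` orbit \<sigma> ` {..<m}"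
    by (simp add: image_image orbit_conjugate[OF bij, unfolded o_def] o_def)
  finally have "cycle_product f m (\<pi> \<circ> \<sigma> \<circ> Hilbert_Choice.inv \<pi>) as =
      (\<Prod>\<gamma>\<in>orbit \<sigma> ` {..<m}. f (\<Prod>r\<in>\<pi> ` \<gamma>. as ! r))"
    by (simp add: cycle_product_def prod.reindex inj_on_def inj_image_eq_iff[OF inj])
  also have "\<dots> = cycle_product f m \<sigma> (permute_list \<pi> as)"
    unfolding cycle_product_def
  proof (rule prod.cong)
    fix \<gamma> assume "\<gamma> \<in> orbit \<sigma> ` {..<m}"
    then have "\<gamma> \<subseteq> {..<m}"
      using permutes_orbit_subset[OF assms(3)] by auto
    then have "(\<Prod>r\<in>\<pi> ` \<gamma>. as ! r) = (\<Prod>r\<in>\<gamma>. permute_list \<pi> as ! r)"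
      using assms inj by (subst prod.reindex)
        (auto intro!: prod.cong simp: permute_list_nth inj_on_subset)
    then show "f (\<Prod>r\<in>\<pi> ` \<gamma>. as ! r) = f (\<Prod>r\<in>\<gamma>. permute_list \<pi> as ! r)"
      by simp
  qed simp
  finally show ?thesis ..
qed

lemma replicate_update_same: "(replicate m x)[i := x] = replicate m x"
  by (cases "i < m") (simp_all add: list_eq_iff_nth_eq nth_list_update)

section \<open>Recursion and symmetry of \<open>Phi\<close>\<close>

context comm_algebra
begin

lemma scale_mult_right: "x * scale c y = scale c (x * y)"
  by (metis mult.commute scale_mult_left)

lemma Phi_Nil: "Phi scale 0 f as * x = x"
proof -
  have "{\<sigma>::nat \<Rightarrow> nat. \<sigma> permutes {}} = {id}"
    by auto
  then show ?thesis
    by (simp add: Phi_def cycle_product_def)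
qed

text \<open>Each permutation of \<open>{..<Suc m}\<close> is uniquely
  \<open>transpose m b \<circ> q\<close> with \<open>q\<close> permuting \<open>{..<m}\<close>. For
  \<open>b = m\<close> the last index is fixed and contributes \<open>f a\<close>; for
  \<open>b < m\<close> it is spliced into the cycle of \<open>b\<close>, with a change of
  sign.\<close>

lemma Phi_snoc:
  assumes "length as = m"
  shows "Phi scale (Suc m) f (as @ [a]) =
    f a * Phi scale m f as - (\<Sum>i<m. Phi scale m f (as[i := as ! i * a]))"
proof -
  let ?g = "\<lambda>\<sigma>. scale (of_int (sign \<sigma>)) (cycle_product f (Suc m) \<sigma> (as @ [a]))"
  have fixed: "?g q = f a * scale (of_int (sign q)) (cycle_product f m q as)"
    if "q permutes {..<m}" for q
    using that assms by (simp add: cycle_product_snoc_fixed scale_mult_right)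
  have moved: "?g (transpose m i \<circ> q) =
      - scale (of_int (sign q)) (cycle_product f m q (as[i := as ! i * a]))"
    if "q permutes {..<m}" "i < m" for q i
  proof -
    have "sign (transpose m i \<circ> q) = - sign q"
      using that permutation_permutes[of q] by (subst sign_compose) (auto simp: sign_swap_id permutation_swap_id)
    then show ?thesis
      using that assms by (simp add: cycle_product_snoc_transpose)
  qed
  have "Phi scale (Suc m) f (as @ [a]) =
     (\<Sum>b\<in>insert m {..<m}. \<Sum>q | q permutes {..<m}. ?g (transpose m b \<circ> q))"
    unfolding Phi_def lessThan_Suc by (rule sum_over_permutations_insert) auto
  also have "\<dots> = (\<Sum>q | q permutes {..<m}. ?g q) +
      (\<Sum>i<m. \<Sum>q | q permutes {..<m}. ?g (transpose m i \<circ> q))"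
    by simp
  also have "\<dots> = f a * Phi scale m f as - (\<Sum>i<m. Phi scale m f (as[i := as ! i * a]))"
    by (simp add: fixed moved Phi_def sum_distrib_left sum_negf)
  finally show ?thesis .
qed

text \<open>Conjugation by \<open>\<pi>\<close> permutes the summands and preserves signs.\<close>

lemma Phi_permute_list:
  assumes "\<pi> permutes {..<m}" "length as = m"
  shows "Phi scale m f (permute_list \<pi> as) = Phi scale m f as"
proof -
  let ?g = "\<lambda>\<sigma>. scale (of_int (sign \<sigma>)) (cycle_product f m \<sigma> as)"
  have sgn: "sign (\<pi> \<circ> \<sigma> \<circ> Hilbert_Choice.inv \<pi>) = sign \<sigma>" if "\<sigma> permutes {..<m}" for \<sigma>
  proof -
    have "permutation \<pi>" "permutation \<sigma>"
      using assms that by (auto simp: permutation_permutes)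
    then show ?thesis
      by (simp add: sign_compose sign_inverse permutation_inverse permutation_compose)
  qed
  \<comment> \<open>The conjugation is a left composition with \<open>\<pi>\<close> followed by a
    right composition with its inverse.\<close>
  have "Phi scale m f as = (\<Sum>\<sigma> | \<sigma> permutes {..<m}. ?g (\<pi> \<circ> \<sigma> \<circ> Hilbert_Choice.inv \<pi>))"
    unfolding Phi_def
    by (subst setum_permutations_compose_left[OF assms(1)],
        subst sum_permutations_compose_right[OF permutes_inv[OF assms(1)]]) (simp add: o_assoc)
  also have "\<dots> = Phi scale m f (permute_list \<pi> as)"
    using assms by (simp add: Phi_def cycle_product_permute_list sgn)
  finally show ?thesis ..
qed

lemma Phi_mset_cong:
  assumes "mset as = mset bs"
  shows "Phi scale (length as) f as = Phi scale (length bs) f bs"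
  using assms mset_eq_permutation[OF assms] Phi_permute_list mset_eq_length[OF assms] by metis

text \<open>Independent of the list chosen by \<open>SOME\<close>, because \<open>Phi\<close> is symmetric.\<close>

definition Phi_mset :: "('c::comm_monoid_mult \<Rightarrow> 'a) \<Rightarrow> 'c multiset \<Rightarrow> 'a"
  where "Phi_mset f M = Phi scale (size M) f (SOME as. mset as = M)"

lemma Phi_mset_mset: "Phi_mset f (mset as) = Phi scale (length as) f as"
proof -
  have "mset (SOME bs. mset bs = mset as) = mset as"
    by (rule someI) simp
  then show ?thesis
    unfolding Phi_mset_def by (metis Phi_mset_cong size_mset)
qed

lemma Phi_mset_empty: "Phi_mset f {#} * x = x"
  using Phi_mset_mset[of f "[]"] by (simp add: Phi_Nil)

lemma Phi_mset_add_mset: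
  "Phi_mset f (add_mset a M) = f a * Phi_mset f M - mult_derivation a (Phi_mset f) M"
proof -
  obtain as where M: "M = mset as"
    using ex_mset by metis
  have "add_mset a M = mset (as @ [a])"
    by (simp add: M)
  then have "Phi_mset f (add_mset a M) = Phi scale (Suc (length as)) f (as @ [a])"
    by (metis Phi_mset_mset length_append_singleton)
  then show ?thesis
    by (simp add: Phi_snoc M mult_derivation_mset Phi_mset_mset mult.commute)
qed

end

section \<open>Multilinearity, vanishing and normalisation of \<open>Phi\<close>\<close>

locale comm_algebra_linear =
  A: comm_algebra sA + B: comm_algebra sB + f: Vector_Spaces.linear sA sB f
  for sA :: "'k::field \<Rightarrow> 'a::{comm_ring, comm_monoid_mult} \<Rightarrow> 'a"
    and sB :: "'k \<Rightarrow> 'b::{comm_ring, comm_monoid_mult} \<Rightarrow> 'b"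
    and f :: "'a \<Rightarrow> 'b"
begin

lemma Phi_update_add:
  assumes "length as = m" "i < m"
  shows "Phi sB m f (as[i := x + y]) = Phi sB m f (as[i := x]) + Phi sB m f (as[i := y])"
  using assms by (simp add: Phi_def cycle_product_update distrib_right f.add
      B.scale_right_distrib sum.distrib)

lemma Phi_update_scale:
  assumes "length as = m" "i < m"
  shows "Phi sB m f (as[i := sA c x]) = sB c (Phi sB m f (as[i := x]))"
  using assms by (simp add: Phi_def cycle_product_update A.scale_mult_left[symmetric] f.scale
      B.scale_mult_left[symmetric] B.scale_sum_right mult.commute)

end

locale frobenius = comm_algebra_linear +
  fixes n :: nat
  assumes Phi_Suc_eq_0: "length as = Suc n \<Longrightarrow> Phi sB (Suc n) f as = 0"
    and f_1: "f 1 = sB (of_nat n) 1"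
begin

text \<open>Beyond size \<open>n + 1\<close>, the recursion only involves multisets with one element
  fewer, which still have more than \<open>n\<close>, so vanishing propagates upwards.\<close>

lemma Phi_mset_eq_0:
  assumes "size M > n"
  shows "B.Phi_mset f M = 0"
  using assms
proof (induction "size M" arbitrary: M rule: less_induct)
  case less
  show ?case
  proof (cases "size M = Suc n")
    case True
    obtain as where "M = mset as"
      using ex_mset by metis
    then show ?thesis
      using True Phi_Suc_eq_0 by (simp add: B.Phi_mset_mset)
  next
    case False
    then obtain a N where M: "M = add_mset a N"
      using less.prems by (metis multiset_cases size_empty not_less0)
    have "B.Phi_mset f N = 0"
      using False less.prems by (intro less.hyps) (auto simp: M)
    moreover have "B.Phi_mset f (add_mset (a * c) (N - {#c#})) = 0" if "c \<in># N" for c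
      using False less.prems that by (intro less.hyps) (auto simp: M size_Diff_singleton)
    then have "mult_derivation a (B.Phi_mset f) N = 0"
      unfolding mult_derivation_def by (intro sum_mset.neutral) auto
    ultimately show ?thesis
      unfolding M B.Phi_mset_add_mset by simp
  qed
qed

lemma Phi_mult_Phi:
  assumes "length as = n" "length bs = n"
  shows "Phi sB n f as * Phi sB n f bs =
    (\<Sum>\<sigma> | \<sigma> permutes {..<n}. Phi sB n f (map2 (*) as (permute_list \<sigma> bs)))"
proof -
  have "B.Phi_mset f (mset (map2 (*) as (permute_list \<sigma> bs))) = Phi sB n f (map2 (*) as (permute_list \<sigma> bs))" for \<sigma>
    using assms B.Phi_mset_mset[of f "map2 (*) as (permute_list \<sigma> bs)"] by simp
  then show ?thesis
    using product_eq_sum_permutations[of "B.Phi_mset f" f n as bs,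
        OF B.Phi_mset_empty B.Phi_mset_add_mset Phi_mset_eq_0 assms] assms
    by (simp only: B.Phi_mset_mset)
qed

text \<open>Multiplying an argument by \<open>1\<close> changes nothing, so on ones the recursion
  turns arity \<open>m\<close> into arity \<open>m + 1\<close> by the factor \<open>n - m\<close>.
  At \<open>m = n\<close> the product is \<open>n!\<close>.\<close>

lemma Phi_replicate_1:
  assumes "m \<le> n"
  shows "Phi sB m f (replicate m 1) = sB (of_nat (\<Prod>i<m. n - i)) 1"
  using assms
proof (induction m)
  case 0
  then show ?case
    using B.Phi_Nil[of f "[]" 1] by simp
next
  case (Suc m)
  have "Phi sB (Suc m) f (replicate (Suc m) 1) =
      f 1 * Phi sB m f (replicate m 1) - (\<Sum>i<m. Phi sB m f ((replicate m 1)[i := 1]))"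
    using B.Phi_snoc[of "replicate m 1" m f 1] by (simp add: replicate_append_same)
  also have "(\<Sum>i<m. Phi sB m f ((replicate m 1)[i := 1])) = (\<Sum>i<m. Phi sB m f (replicate m 1))"
  proof (rule sum.cong)
    fix i assume "i \<in> {..<m}"
    then show "Phi sB m f ((replicate m 1)[i := 1]) = Phi sB m f (replicate m 1)"
      by (simp add: replicate_update_same)
  qed simp
  also have "\<dots> = sB (of_nat m) (Phi sB m f (replicate m 1))"
    using B.sum_constant_scale[of _ "{..<m}"] by simp
  also have "f 1 * Phi sB m f (replicate m 1) = sB (of_nat n) (Phi sB m f (replicate m 1))"
    by (simp add: f_1 B.scale_mult_left[symmetric])
  finally show ?case
    using Suc by (simp add: B.scale_left_diff_distrib[symmetric] of_nat_diff mult.commute left_diff_distrib)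
qed

lemma Phi_1: "Phi sB n f (replicate n 1) = sB (of_nat (fact n)) 1"
proof -
  have "(\<Prod>i<n. n - i) = fact n"
    by (simp add: fact_prod_rev lessThan_atLeast0)
  then show ?thesis
    using Phi_replicate_1[of n] by simp
qed

end

section \<open>The tensor power\<close>

text \<open>The support condition is carried along so that the length of a tuple is known in the
  \<open>single\<close> case.\<close>

lemma poly_mapping_single_induct [consumes 1, case_names zero single add]:
  assumes "Poly_Mapping.keys p \<subseteq> X"
    and "P 0"
    and "\<And>x c. x \<in> X \<Longrightarrow> P (Poly_Mapping.single x c)"
    and "\<And>p q. Poly_Mapping.keys p \<subseteq> X \<Longrightarrow> Poly_Mapping.keys q \<subseteq> X \<Longrightarrow> P p \<Longrightarrow> P q \<Longrightarrow> P (p + q)"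
  shows "P (p :: 'x \<Rightarrow>\<^sub>0 'k::comm_monoid_add)"
  using assms(1)
proof (induction p rule: update_induct)
  case const
  show ?case by (rule assms(2))
next
  case (update p x c)
  have "Poly_Mapping.update x c p = p + Poly_Mapping.single x c"
    using update.hyps(1)
    by (intro poly_mapping_eqI) (auto simp: lookup_update lookup_add lookup_single not_in_keys_iff_lookup_eq_zero)
  moreover have "Poly_Mapping.keys (Poly_Mapping.update x c p) = insert x (Poly_Mapping.keys p)"
    using update.hyps(2) by (simp add: keys_update)
  ultimately show ?case
    using update assms(3,4) by (auto split: if_splits)
qed

context vector_space
begin

text \<open>Coefficients outside \<open>keys p\<close> are zero. Enlarging the support lets the sums
  for \<open>p\<close>, \<open>q\<close> and \<open>p + q\<close> run over one index set, even if
  terms cancel.\<close>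

lemma linear_extension_superset:
  assumes "finite S" "Poly_Mapping.keys p \<subseteq> S"
  shows "linear_extension scale g p = (\<Sum>x\<in>S. scale (Poly_Mapping.lookup p x) (g x))"
  unfolding linear_extension_def using assms
  by (intro sum.mono_neutral_left) (auto simp: not_in_keys_iff_lookup_eq_zero)

lemma linear_extension_single [simp]:
  "linear_extension scale g (Poly_Mapping.single x c) = scale c (g x)"
  by (subst linear_extension_superset[of "{x}"]) auto

lemma linear_linear_extension: "Vector_Spaces.linear free_scale scale (linear_extension scale (g :: 'x \<Rightarrow> 'b))"
  unfolding Vector_Spaces.linear_iff
proof (intro conjI allI)
  show "vector_space (free_scale :: 'a \<Rightarrow> ('x \<Rightarrow>\<^sub>0 'a) \<Rightarrow> _)"
    by (rule free.vector_space_axioms)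
  show "vector_space scale"
    by (rule vector_space_axioms)
  fix p q :: "'x \<Rightarrow>\<^sub>0 'a"
  let ?S = "Poly_Mapping.keys p \<union> Poly_Mapping.keys q"
  have "Poly_Mapping.keys (p + q) \<subseteq> ?S"
    by (rule Poly_Mapping.keys_add)
  then show "linear_extension scale g (p + q) = linear_extension scale g p + linear_extension scale g q"
    by (simp add: linear_extension_superset[of ?S] lookup_add scale_left_distrib sum.distrib)
next
  fix c and p :: "'x \<Rightarrow>\<^sub>0 'a"
  have "Poly_Mapping.keys (free_scale c p) \<subseteq> Poly_Mapping.keys p"
    by (auto simp: in_keys_iff)
  then show "linear_extension scale g (free_scale c p) = scale c (linear_extension scale g p)"
    by (simp add: linear_extension_superset[of "Poly_Mapping.keys p"] scale_sum_right)
qed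

lemmas linear_extension_add = module_hom.add[OF module_hom_linearI[OF linear_linear_extension]]
  and linear_extension_diff = module_hom.diff[OF module_hom_linearI[OF linear_linear_extension]]
  and linear_extension_scale = module_hom.scale[OF module_hom_linearI[OF linear_linear_extension]]
  and linear_extension_zero = module_hom.zero[OF module_hom_linearI[OF linear_linear_extension]]

end

section \<open>Componentwise multiplication of formal sums of tuples\<close>

lemma free_scale_single: "free_scale c (Poly_Mapping.single x d) = Poly_Mapping.single x (c * d)"
  by (rule poly_mapping_eqI) (simp add: lookup_single when_def)

text \<open>Written as an iterated linear extension, the product is visibly linear on the left;
  commutativity transfers this to the right.\<close>

lemma free_mult_eq_linear_extension:
  "free_mult p q = linear_extension free_scale
     (\<lambda>xs. linear_extension free_scale (\<lambda>ys. Poly_Mapping.single (map2 (*) xs ys) 1) q) p"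
  by (simp add: free_mult_def linear_extension_def free.scale_sum_right free_scale_single)

lemma map2_mult_commute: "map2 (*) xs ys = map2 (*) ys (xs :: 'a::ab_semigroup_mult list)"
  by (induction xs ys rule: list_induct2') (simp_all add: mult.commute)

lemma map2_mult_assoc:
  "map2 (*) (map2 (*) xs ys) zs = map2 (*) xs (map2 (*) ys (zs :: 'a::semigroup_mult list))"
proof (induction xs arbitrary: ys zs)
  case (Cons x xs)
  then show ?case
    by (cases ys; cases zs) (simp_all add: mult.assoc)
qed simp

lemma map2_mult_1: "map2 (*) (replicate (length xs) 1) xs = (xs :: 'a::monoid_mult list)"
  by (induction xs) simp_all

lemma free_mult_commute:
  fixes p q :: "'a::ab_semigroup_mult list \<Rightarrow>\<^sub>0 'k::field"
  shows "free_mult p q = free_mult q p"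
  unfolding free_mult_def by (subst sum.swap) (simp add: map2_mult_commute mult.commute)

lemma free_mult_single:
  "free_mult (Poly_Mapping.single xs c) (Poly_Mapping.single ys d) =
     Poly_Mapping.single (map2 (*) xs ys) (c * d)"
  by (simp add: free_mult_eq_linear_extension free_scale_single)

lemma linear_free_mult_left: "Vector_Spaces.linear free_scale free_scale (\<lambda>p. free_mult p q)"
  unfolding free_mult_eq_linear_extension by (rule free.linear_linear_extension)

lemma linear_free_mult_right:
  fixes p :: "'a::ab_semigroup_mult list \<Rightarrow>\<^sub>0 'k::field"
  shows "Vector_Spaces.linear free_scale free_scale (free_mult p)"
  using linear_free_mult_left[of p] by (simp add: free_mult_commute[of _ p])

lemmas free_mult_left_simps =
  module_hom.add[OF module_hom_linearI[OF linear_free_mult_left]] module_hom.zero[OF module_hom_linearI[OF linear_free_mult_left]]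

lemmas free_mult_right_simps =
  module_hom.add[OF module_hom_linearI[OF linear_free_mult_right]] module_hom.zero[OF module_hom_linearI[OF linear_free_mult_right]]

text \<open>By additivity in each argument, single tuples suffice. The truncating
  \<open>map2\<close> is associative for lists of any lengths, so the support set is
  \<open>UNIV\<close>.\<close>

lemma free_mult_assoc:
  fixes p q r :: "'a::ab_semigroup_mult list \<Rightarrow>\<^sub>0 'k::field"
  shows "free_mult (free_mult p q) r = free_mult p (free_mult q r)"
proof (rule poly_mapping_single_induct[of p UNIV])
  fix xs c
  show "free_mult (free_mult (Poly_Mapping.single xs c) q) r =
      free_mult (Poly_Mapping.single xs c) (free_mult q r)"
  proof (rule poly_mapping_single_induct[of q UNIV])
    fix ys d
    show "free_mult (free_mult (Poly_Mapping.single xs c) (Poly_Mapping.single ys d)) r =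
        free_mult (Poly_Mapping.single xs c) (free_mult (Poly_Mapping.single ys d) r)"
      by (rule poly_mapping_single_induct[of r UNIV])
        (simp_all add: free_mult_single free_mult_right_simps map2_mult_assoc mult.assoc)
  qed (simp_all add: free_mult_left_simps free_mult_right_simps)
qed (simp_all add: free_mult_left_simps)

lemma tuple_algebra_simps [simp]:
  "mult (tuple_algebra n) = free_mult"
  "one (tuple_algebra n) = Poly_Mapping.single (replicate n 1) 1"
  "zero (tuple_algebra n) = 0"
  "add (tuple_algebra n) = (+)"
  by (simp_all add: tuple_algebra_def)

lemma carrier_tuple_algebra:
  "p \<in> carrier (tuple_algebra n) \<longleftrightarrow> Poly_Mapping.keys p \<subseteq> {xs. length xs = n}"
  by (auto simp: tuple_algebra_def)

lemma tuple_algebra_induct [consumes 1, case_names zero single add]: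
  assumes "p \<in> carrier (tuple_algebra n)"
    and "P 0"
    and "\<And>xs c. length xs = n \<Longrightarrow> P (Poly_Mapping.single xs c)"
    and "\<And>p q. p \<in> carrier (tuple_algebra n) \<Longrightarrow> q \<in> carrier (tuple_algebra n)
      \<Longrightarrow> P p \<Longrightarrow> P q \<Longrightarrow> P (p + q)"
  shows "P p"
  using assms(1)[unfolded carrier_tuple_algebra]
  by (rule poly_mapping_single_induct) (use assms(2-4) in \<open>auto simp: carrier_tuple_algebra\<close>)

lemma subspace_tuple_algebra: "free.subspace (carrier (tuple_algebra n) :: ('a::{comm_ring, comm_monoid_mult} list \<Rightarrow>\<^sub>0 'k::field) set)"
proof (rule free.subspaceI)
  show "p + q \<in> carrier (tuple_algebra n)"
    if "p \<in> carrier (tuple_algebra n)" "q \<in> carrier (tuple_algebra n)" for p q :: "'a list \<Rightarrow>\<^sub>0 'k"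
    using that Poly_Mapping.keys_add[of p q] unfolding carrier_tuple_algebra by blast
  show "free_scale c p \<in> carrier (tuple_algebra n)"
    if "p \<in> carrier (tuple_algebra n)" for p :: "'a list \<Rightarrow>\<^sub>0 'k" and c
    using that unfolding carrier_tuple_algebra by (auto simp: in_keys_iff)
qed (simp add: carrier_tuple_algebra)

lemma single_in_tuple_algebra:
  "length xs = n \<Longrightarrow> Poly_Mapping.single xs c \<in> carrier (tuple_algebra n)"
  by (simp add: carrier_tuple_algebra)

lemma free_mult_in_tuple_algebra:
  assumes "p \<in> carrier (tuple_algebra n)" "q \<in> carrier (tuple_algebra n)"
  shows "free_mult p q \<in> carrier (tuple_algebra n)"
  using assms(1)
proof (induction rule: tuple_algebra_induct)
  case zero
  show ?case by (simp add: free_mult_left_simps carrier_tuple_algebra)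
next
  case (single xs c)
  show ?case using assms(2)
  proof (induction rule: tuple_algebra_induct)
    case zero
    show ?case by (simp add: free_mult_right_simps carrier_tuple_algebra)
  next
    case (single ys d)
    with \<open>length xs = n\<close> show ?case by (simp add: free_mult_single single_in_tuple_algebra)
  next
    case (add p q)
    then show ?case
      by (simp add: free_mult_right_simps free.subspace_add[OF subspace_tuple_algebra])
  qed
next
  case (add p q)
  then show ?case
    by (simp add: free_mult_left_simps free.subspace_add[OF subspace_tuple_algebra])
qed

lemma free_mult_one:
  assumes "p \<in> carrier (tuple_algebra n)"
  shows "free_mult (Poly_Mapping.single (replicate n 1) 1) p = p"
  using assms
  by (induction rule: tuple_algebra_induct)
    (auto simp: free_mult_single free_mult_right_simps map2_mult_1)

lemma cring_tuple_algebra: "cring (tuple_algebra n :: ('a::{comm_ring, comm_monoid_mult} list \<Rightarrow>\<^sub>0 'k::field) ring)"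
proof (rule cringI)
  have "\<exists>q\<in>carrier (tuple_algebra n). q + p = 0" if "p \<in> carrier (tuple_algebra n)"
    for p :: "'a list \<Rightarrow>\<^sub>0 'k"
    using that by (intro bexI[of _ "- p"]) (simp_all add: carrier_tuple_algebra)
  then show "abelian_group (tuple_algebra n :: ('a list \<Rightarrow>\<^sub>0 'k) ring)"
    by (intro abelian_groupI) (simp_all add: add_ac free.subspace_add[OF subspace_tuple_algebra]
      free.subspace_0[OF subspace_tuple_algebra])
  show "comm_monoid (tuple_algebra n)"
    by (rule comm_monoidI) (auto simp: free_mult_in_tuple_algebra free_mult_assoc free_mult_one
        single_in_tuple_algebra intro: free_mult_commute)
qed (simp add: free_mult_left_simps)

section \<open>The span of the multilinear relations\<close>

lemma linear_span_subset:
  assumes "Vector_Spaces.linear free_scale free_scale T"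
    and "\<And>r. r \<in> R \<Longrightarrow> T r \<in> free.span R'" and "p \<in> free.span R"
  shows "T p \<in> free.span R'"
proof -
  interpret T: Vector_Spaces.linear free_scale free_scale T by fact
  have "T ` free.span R = free.span (T ` R)"
    by (simp add: T.span_image)
  also have "\<dots> \<subseteq> free.span R'"
    using assms(2) by (intro free.span_minimal) (auto simp: free.subspace_span)
  finally show ?thesis
    using assms(3) by blast
qed

lemma multilinear_relations_cases [consumes 1, case_names add scale]:
  assumes "r \<in> multilinear_relations s n"
  obtains
    xs i a b where "length xs = n" "i < n"
      "r = Poly_Mapping.single (xs[i := a + b]) 1 - Poly_Mapping.single (xs[i := a]) 1
        - Poly_Mapping.single (xs[i := b]) 1"
  | xs i c a where "length xs = n" "i < n"
      "r = Poly_Mapping.single (xs[i := s c a]) 1 - free_scale c (Poly_Mapping.single (xs[i := a]) 1)"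
  using assms unfolding multilinear_relations_def by blast

lemma span_multilinear_relations_subset:
  "free.span (multilinear_relations s n) \<subseteq> carrier (tuple_algebra n)"
proof (rule free.span_minimal[OF _ subspace_tuple_algebra], rule subsetI)
  fix r assume "r \<in> multilinear_relations s n"
  then show "r \<in> carrier (tuple_algebra n)"
    by (cases rule: multilinear_relations_cases)
      (auto intro!: free.subspace_diff[OF subspace_tuple_algebra]
        free.subspace_scale[OF subspace_tuple_algebra] single_in_tuple_algebra)
qed

lemma relation_add_in_span:
  assumes "length xs = n" "i < n"
  shows "Poly_Mapping.single (xs[i := a + b]) 1 - Poly_Mapping.single (xs[i := a]) 1
    - Poly_Mapping.single (xs[i := b]) 1 \<in> free.span (multilinear_relations s n)"
  using assms unfolding multilinear_relations_def by (intro free.span_base) blast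

lemma relation_scale_in_span:
  assumes "length xs = n" "i < n"
  shows "Poly_Mapping.single (xs[i := s c a]) 1 - free_scale c (Poly_Mapping.single (xs[i := a]) 1)
    \<in> free.span (multilinear_relations s n)"
  using assms unfolding multilinear_relations_def by (intro free.span_base) blast

lemma map2_mult_update:
  "i < length xs \<Longrightarrow> i < length ys \<Longrightarrow> map2 (*) ys (xs[i := a]) = (map2 (*) ys xs)[i := ys ! i * a]"
  by (simp add: list_eq_iff_nth_eq nth_list_update)

section \<open>Permutation of tensor positions\<close>

text \<open>The action behind \<open>permute_tensor\<close> on representatives, so that cosets can
  be treated through single elements.\<close>

definition permute_free :: "(nat \<Rightarrow> nat) \<Rightarrow> ('a list \<Rightarrow>\<^sub>0 'k::field) \<Rightarrow> ('a list \<Rightarrow>\<^sub>0 'k)"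
  where "permute_free \<sigma> = linear_extension free_scale (\<lambda>xs. Poly_Mapping.single (permute_list \<sigma> xs) 1)"

lemma permute_tensor_eq: "permute_tensor \<sigma> t = permute_free \<sigma> ` t"
  by (simp add: permute_tensor_def permute_free_def)

lemma linear_permute_free: "Vector_Spaces.linear free_scale free_scale (permute_free \<sigma>)"
  unfolding permute_free_def by (rule free.linear_linear_extension)

lemma permute_free_single [simp]:
  "permute_free \<sigma> (Poly_Mapping.single xs c) = Poly_Mapping.single (permute_list \<sigma> xs) c"
  by (simp add: permute_free_def free_scale_single)

lemmas permute_free_simps =
  module_hom.add[OF module_hom_linearI[OF linear_permute_free]] module_hom.zero[OF module_hom_linearI[OF linear_permute_free]]
  module_hom.diff[OF module_hom_linearI[OF linear_permute_free]] module_hom.scale[OF module_hom_linearI[OF linear_permute_free]]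

lemma permute_free_in_tuple_algebra:
  assumes "p \<in> carrier (tuple_algebra n)"
  shows "permute_free \<sigma> p \<in> carrier (tuple_algebra n)"
  using assms
  by (induction rule: tuple_algebra_induct)
    (auto simp: permute_free_simps single_in_tuple_algebra
      free.subspace_0[OF subspace_tuple_algebra] free.subspace_add[OF subspace_tuple_algebra])

lemma permute_list_map2:
  assumes "\<sigma> permutes {..<n}" "length xs = n" "length ys = n"
  shows "permute_list \<sigma> (map2 g xs ys) = map2 g (permute_list \<sigma> xs) (permute_list \<sigma> ys)"
  using assms by (simp add: permute_list_map permute_list_zip)

text \<open>Position \<open>k\<close> of the permuted list holds the entry at
  \<open>\<sigma> k\<close>, so the entry at \<open>i\<close> moves to the \<open>k\<close> with
  \<open>\<sigma> k = i\<close>.\<close>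

lemma permute_list_update:
  assumes "\<sigma> permutes {..<n}" "length xs = n" "i < n"
  shows "permute_list \<sigma> (xs[i := a]) = (permute_list \<sigma> xs)[Hilbert_Choice.inv \<sigma> i := a]"
proof -
  define k where "k = Hilbert_Choice.inv \<sigma> i"
  have i: "i = \<sigma> k"
    using assms(1) by (simp add: k_def permutes_inverses)
  have "k < n"
    using assms(3) permutes_in_image[OF assms(1), of k] i by simp
  then have "permute_list \<sigma> (xs[\<sigma> k := a]) = (permute_list \<sigma> xs)[k := a]"
    using assms(2) permutes_in_image[OF assms(1)] assms(1)
    by (intro nth_equalityI) (simp_all add: nth_list_update permute_list_nth inj_eq[OF permutes_inj[OF assms(1)]])
  then show ?thesis
    unfolding i[symmetric] k_def[symmetric] .
qed

lemma permute_free_mult: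
  fixes p q :: "'a::ab_semigroup_mult list \<Rightarrow>\<^sub>0 'k::field"
  assumes "\<sigma> permutes {..<n}" "Poly_Mapping.keys p \<subseteq> {xs. length xs = n}" "Poly_Mapping.keys q \<subseteq> {xs. length xs = n}"
  shows "permute_free \<sigma> (free_mult p q) = free_mult (permute_free \<sigma> p) (permute_free \<sigma> q)"
  using assms(2)
proof (induction rule: poly_mapping_single_induct)
  case (single xs c)
  show ?case using assms(3)
  proof (induction rule: poly_mapping_single_induct)
    case (single ys d)
    with \<open>xs \<in> _\<close> show ?case
      using permute_list_map2[OF assms(1), of xs ys "(*)"] by (simp add: free_mult_single)
  qed (simp_all add: free_mult_right_simps permute_free_simps)
qed (simp_all add: free_mult_left_simps permute_free_simps)

text \<open>A relation at position \<open>i\<close> becomes one of the same kind at position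
  \<open>inv \<sigma> i\<close>; linearity extends this to the span.\<close>

lemma permute_free_in_span:
  assumes "\<sigma> permutes {..<n}" "p \<in> free.span (multilinear_relations s n)"
  shows "permute_free \<sigma> p \<in> free.span (multilinear_relations s n)"
  using linear_permute_free _ assms(2)
proof (rule linear_span_subset)
  fix r assume "r \<in> multilinear_relations s n"
  moreover have inv: "Hilbert_Choice.inv \<sigma> i < n" if "i < n" for i
    using permutes_in_image[OF permutes_inv[OF assms(1)], of i] that by simp
  ultimately show "permute_free \<sigma> r \<in> free.span (multilinear_relations s n)"
    by (cases rule: multilinear_relations_cases)
      (simp_all add: permute_free_simps permute_list_update[OF assms(1)]
        relation_add_in_span relation_scale_in_span)
qed

lemma permute_free_inv:
  assumes "\<sigma> permutes {..<n}" "p \<in> carrier (tuple_algebra n)"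
  shows "permute_free \<sigma> (permute_free (Hilbert_Choice.inv \<sigma>) p) = p"
  using assms(2)
proof (induction rule: tuple_algebra_induct)
  case (single xs c)
  have "permute_list \<sigma> (permute_list (Hilbert_Choice.inv \<sigma>) xs) = xs"
    using permute_list_compose[of \<sigma> xs "Hilbert_Choice.inv \<sigma>"] assms single
    by (metis permute_list_compose permute_list_id permutes_inv_o(2))
  then show ?case by simp
qed (simp_all add: permute_free_simps)

lemma fixed_points_subring:
  assumes "ring R" "\<And>i. P i \<Longrightarrow> h i \<in> ring_hom R R"
  shows "subring {x \<in> carrier R. \<forall>i. P i \<longrightarrow> h i x = x} R" (is "subring ?F R")
proof -
  interpret ring R by fact
  have "h i (\<ominus>\<^bsub>R\<^esub> x) = \<ominus>\<^bsub>R\<^esub> x" if "P i" "x \<in> ?F" for i x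
  proof -
    interpret ring_hom_ring R R "h i"
      using assms that(1) by (simp add: ring_hom_ringI2)
    show ?thesis using that by simp
  qed
  moreover have "h i (x \<otimes>\<^bsub>R\<^esub> y) = x \<otimes>\<^bsub>R\<^esub> y" "h i (x \<oplus>\<^bsub>R\<^esub> y) = x \<oplus>\<^bsub>R\<^esub> y"
    if "P i" "x \<in> ?F" "y \<in> ?F" for i x y
    using that ring_hom_mult[OF assms(2)] ring_hom_add[OF assms(2)] by simp_all
  ultimately show ?thesis
    by (intro subringI) (auto simp: ring_hom_one[OF assms(2)])
qed

section \<open>The ideal of relations\<close>

context comm_algebra
begin

abbreviation relations_span :: "nat \<Rightarrow> ('a list \<Rightarrow>\<^sub>0 'k) set"
  where "relations_span n \<equiv> free.span (multilinear_relations scale n)"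

text \<open>Multiplying a relation at position \<open>i\<close> by a tuple \<open>ys\<close> gives a
  relation of the same kind at \<open>i\<close>, with the varying entries multiplied by
  \<open>ys ! i\<close>.\<close>

lemma free_mult_in_span:
  assumes "p \<in> carrier (tuple_algebra n)" "q \<in> relations_span n"
  shows "free_mult p q \<in> relations_span n"
  using assms(1)
proof (induction rule: tuple_algebra_induct)
  case zero
  show ?case by (simp add: free_mult_left_simps free.span_zero)
next
  case (single ys d)
  show ?case
    using linear_free_mult_right _ assms(2)
  proof (rule linear_span_subset)
    fix r assume "r \<in> multilinear_relations scale n"
    then show "free_mult (Poly_Mapping.single ys d) r \<in> relations_span n"
    proof (cases rule: multilinear_relations_cases)
      case (add xs i a b)
      let ?zs = "map2 (*) ys xs" and ?c = "ys ! i"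
      have "free_mult (Poly_Mapping.single ys d) r = free_scale d
          (Poly_Mapping.single (?zs[i := ?c * a + ?c * b]) 1 - Poly_Mapping.single (?zs[i := ?c * a]) 1
            - Poly_Mapping.single (?zs[i := ?c * b]) 1)"
        using add single
        by (simp add: module_hom.diff[OF module_hom_linearI[OF linear_free_mult_right]] free_mult_single
            map2_mult_update distrib_left free.scale_right_diff_distrib free_scale_single)
      then show ?thesis
        using add single by (simp add: free.span_scale relation_add_in_span)
    next
      case (scale xs i c a)
      let ?zs = "map2 (*) ys xs" and ?c = "ys ! i"
      have "free_mult (Poly_Mapping.single ys d) r = free_scale d
          (Poly_Mapping.single (?zs[i := scale c (?c * a)]) 1
            - free_scale c (Poly_Mapping.single (?zs[i := ?c * a]) 1))"
        using scale single
        by (simp add: module_hom.diff[OF module_hom_linearI[OF linear_free_mult_right]] free_mult_single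
            map2_mult_update scale_mult_right free.scale_right_diff_distrib free_scale_single mult.commute)
      then show ?thesis
        using scale single by (simp add: free.span_scale relation_scale_in_span)
    qed
  qed
next
  case (add p q)
  then show ?case
    by (simp add: free_mult_left_simps free.span_add)
qed

lemma ideal_relations_span: "ideal (relations_span n) (tuple_algebra n)"
proof -
  interpret cring "tuple_algebra n :: ('a list \<Rightarrow>\<^sub>0 'k) ring"
    by (rule cring_tuple_algebra)
  note sub = subsetD[OF span_multilinear_relations_subset]
  show ?thesis
  proof (rule idealI)
    show "subgroup (relations_span n) (add_monoid (tuple_algebra n))"
    proof (rule add.subgroupI)
      show "relations_span n \<subseteq> carrier (tuple_algebra n)"
        by (rule span_multilinear_relations_subset)
      show "relations_span n \<noteq> {}"
        using free.span_zero by auto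
      fix p assume p: "p \<in> relations_span n"
      \<comment> \<open>The abstract additive inverse of the ring structure is identified with
        \<open>- p\<close> by uniqueness of inverses.\<close>
      have "\<ominus>\<^bsub>tuple_algebra n\<^esub> p = - p"
        using sub[OF p] sub[OF free.span_neg[OF p]] by (intro minus_equality) simp_all
      then show "\<ominus>\<^bsub>tuple_algebra n\<^esub> p \<in> relations_span n"
        using free.span_neg[OF p] by simp
    qed (simp add: free.span_add)
    show "p \<otimes>\<^bsub>tuple_algebra n\<^esub> q \<in> relations_span n"
      if "p \<in> relations_span n" "q \<in> carrier (tuple_algebra n)" for p q
      using free_mult_in_span[OF that(2,1)] by (simp add: free_mult_commute)
  qed (simp_all add: ring_axioms free_mult_in_span)
qed

end

section \<open>The quotient ring and its invariants\<close>

lemma r_coset_tuple_algebra: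
  "I +>\<^bsub>tuple_algebra n\<^esub> p = (\<lambda>i. i + p) ` I"
  by (auto simp: a_r_coset_def r_coset_def)

lemma carrier_FactRing_tuple_algebra:
  "carrier (tuple_algebra n Quot I) = (\<lambda>p. I +>\<^bsub>tuple_algebra n\<^esub> p) ` carrier (tuple_algebra n)"
  by (auto simp: FactRing_def A_RCOSETS_def RCOSETS_def a_r_coset_def)

lemma ring_type_ring: "ring (type_ring :: 'b::{comm_ring, comm_monoid_mult} ring)"
proof (rule ringI)
  have "\<exists>y. y + x = 0" for x :: 'b
    by (intro exI[of _ "- x"]) simp
  then show "abelian_group (type_ring :: 'b ring)"
    by (intro abelian_groupI) (simp_all add: type_ring_def add_ac)
  show "Group.monoid (type_ring :: 'b ring)"
    by (rule monoidI) (simp_all add: type_ring_def mult_ac)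
qed (simp_all add: type_ring_def distrib_left distrib_right)

context comm_algebra
begin

lemma ring_tensor_power: "ring (tensor_power scale n)"
  unfolding tensor_power_def by (rule ideal.quotient_is_ring[OF ideal_relations_span])

lemma coset_mult:
  assumes "p \<in> carrier (tuple_algebra n)" "q \<in> carrier (tuple_algebra n)"
  shows "(relations_span n +>\<^bsub>tuple_algebra n\<^esub> p) \<otimes>\<^bsub>tensor_power scale n\<^esub>
      (relations_span n +>\<^bsub>tuple_algebra n\<^esub> q) =
    relations_span n +>\<^bsub>tuple_algebra n\<^esub> free_mult p q"
  using ideal.rcoset_mult_add[OF ideal_relations_span assms]
  by (simp add: tensor_power_def FactRing_def)

lemma coset_add:
  assumes "p \<in> carrier (tuple_algebra n)" "q \<in> carrier (tuple_algebra n)"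
  shows "(relations_span n +>\<^bsub>tuple_algebra n\<^esub> p) \<oplus>\<^bsub>tensor_power scale n\<^esub>
      (relations_span n +>\<^bsub>tuple_algebra n\<^esub> q) =
    relations_span n +>\<^bsub>tuple_algebra n\<^esub> (p + q)"
  using ring_hom_add[OF ideal.rcos_ring_hom[OF ideal_relations_span] assms]
  by (simp add: tensor_power_def)

lemma one_tensor_power:
  "\<one>\<^bsub>tensor_power scale n\<^esub> =
    relations_span n +>\<^bsub>tuple_algebra n\<^esub> Poly_Mapping.single (replicate n 1) 1"
  by (simp add: tensor_power_def FactRing_def)

lemma carrier_tensor_power:
  "carrier (tensor_power scale n) =
    (\<lambda>p. relations_span n +>\<^bsub>tuple_algebra n\<^esub> p) ` carrier (tuple_algebra n)"
  by (simp add: tensor_power_def carrier_FactRing_tuple_algebra)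

text \<open>As \<open>permute_tensor\<close> takes images of sets, a full coset results because
  \<open>permute_free \<sigma>\<close> maps the span onto itself; surjectivity comes from the
  inverse permutation.\<close>

lemma permute_tensor_coset:
  assumes "\<sigma> permutes {..<n}"
  shows "permute_tensor \<sigma> (relations_span n +>\<^bsub>tuple_algebra n\<^esub> p) =
    relations_span n +>\<^bsub>tuple_algebra n\<^esub> permute_free \<sigma> p"
proof -
  have "permute_free \<sigma> ` relations_span n = relations_span n"
  proof
    show "permute_free \<sigma> ` relations_span n \<subseteq> relations_span n"
      using permute_free_in_span[OF assms] by blast
    show "relations_span n \<subseteq> permute_free \<sigma> ` relations_span n"
    proof
      fix p assume p: "p \<in> relations_span n"
      then have "p = permute_free \<sigma> (permute_free (Hilbert_Choice.inv \<sigma>) p)"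
        by (intro permute_free_inv[OF assms, symmetric] subsetD[OF span_multilinear_relations_subset])
      then show "p \<in> permute_free \<sigma> ` relations_span n"
        using permute_free_in_span[OF permutes_inv[OF assms] p] by (rule image_eqI)
    qed
  qed
  moreover have "permute_tensor \<sigma> (relations_span n +>\<^bsub>tuple_algebra n\<^esub> p) =
      (\<lambda>i. i + permute_free \<sigma> p) ` permute_free \<sigma> ` relations_span n"
    by (simp add: permute_tensor_eq r_coset_tuple_algebra image_image permute_free_simps)
  ultimately show ?thesis
    by (simp add: r_coset_tuple_algebra)
qed

lemma permute_tensor_ring_hom:
  assumes "\<sigma> permutes {..<n}"
  shows "permute_tensor \<sigma> \<in> ring_hom (tensor_power scale n) (tensor_power scale n)"
proof (rule ring_hom_memI)
  note coset = permute_tensor_coset[OF assms]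
  note closed = permute_free_in_tuple_algebra[of _ n \<sigma>]
  show "permute_tensor \<sigma> t \<in> carrier (tensor_power scale n)"
    if "t \<in> carrier (tensor_power scale n)" for t
    using that closed unfolding carrier_tensor_power by (auto simp only: coset intro!: imageI)
  have "permute_list \<sigma> (replicate n 1) = replicate n (1 :: 'a)"
    using permutes_in_image[OF assms] by (intro nth_equalityI) (auto simp: permute_list_nth assms)
  then show "permute_tensor \<sigma> \<one>\<^bsub>tensor_power scale n\<^esub> = \<one>\<^bsub>tensor_power scale n\<^esub>"
    by (simp add: one_tensor_power coset)
  fix t u
  assume "t \<in> carrier (tensor_power scale n)" "u \<in> carrier (tensor_power scale n)"
  then obtain p q where p: "p \<in> carrier (tuple_algebra n)" "t = relations_span n +>\<^bsub>tuple_algebra n\<^esub> p"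
    and q: "q \<in> carrier (tuple_algebra n)" "u = relations_span n +>\<^bsub>tuple_algebra n\<^esub> q"
    unfolding carrier_tensor_power by blast
  show "permute_tensor \<sigma> (t \<otimes>\<^bsub>tensor_power scale n\<^esub> u) =
      permute_tensor \<sigma> t \<otimes>\<^bsub>tensor_power scale n\<^esub> permute_tensor \<sigma> u"
    using p q permute_free_mult[OF assms, of p q]
    by (simp add: coset_mult coset closed carrier_tuple_algebra[symmetric])
  show "permute_tensor \<sigma> (t \<oplus>\<^bsub>tensor_power scale n\<^esub> u) =
      permute_tensor \<sigma> t \<oplus>\<^bsub>tensor_power scale n\<^esub> permute_tensor \<sigma> u"
    using p q by (simp add: coset_add coset closed permute_free_simps)
qed

lemma ring_symmetric_tensors: "ring (symmetric_tensors scale n)"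
proof -
  have "subring {t \<in> carrier (tensor_power scale n).
      \<forall>\<sigma>. \<sigma> permutes {..<n} \<longrightarrow> permute_tensor \<sigma> t = t} (tensor_power scale n)"
    by (rule fixed_points_subring[OF ring_tensor_power permute_tensor_ring_hom])
  from ring.subring_is_ring[OF ring_tensor_power this] show ?thesis
    unfolding symmetric_tensors_def .
qed

end

section \<open>The induced map on symmetric tensors\<close>

context frobenius
begin

abbreviation Phi_free :: "('b list \<Rightarrow>\<^sub>0 'a) \<Rightarrow> 'c"
  where "Phi_free \<equiv> linear_extension sB (Phi sB n f)"

text \<open>Multilinearity of \<open>Phi\<close> kills the generators, hence their span.\<close>

lemma Phi_free_relations:
  assumes "p \<in> A.relations_span n"
  shows "Phi_free p = 0"
proof (rule module_hom.eq_0_on_span[OF module_hom_linearI[OF B.linear_linear_extension] _ assms])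
  fix r assume "r \<in> multilinear_relations sA n"
  then show "Phi_free r = 0"
    by (cases rule: multilinear_relations_cases)
      (simp_all add: B.linear_extension_diff B.linear_extension_scale Phi_update_add Phi_update_scale)
qed

lemma induced_map_coset:
  "induced_map sB (Phi sB n f) (A.relations_span n +>\<^bsub>tuple_algebra n\<^esub> p) = Phi_free p"
proof -
  \<comment> \<open>The extension is constant on the coset, and \<open>0\<close> in the span makes
    the coset nonempty, so \<open>the_elem\<close> is applied to a singleton.\<close>
  have "Phi_free ` (A.relations_span n +>\<^bsub>tuple_algebra n\<^esub> p) = {Phi_free p}"
    using free.span_zero[of "multilinear_relations sA n"]
    by (auto simp: r_coset_tuple_algebra image_image B.linear_extension_add Phi_free_relations)
  then show ?thesis
    by (simp add: induced_map_def)
qed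

text \<open>Both sides are additive in \<open>p\<close> and in \<open>q\<close>, which reduces the
  claim to the formula for single tuples.\<close>

lemma Phi_free_mult:
  assumes "p \<in> carrier (tuple_algebra n)" "q \<in> carrier (tuple_algebra n)"
  shows "Phi_free p * Phi_free q =
    (\<Sum>\<sigma> | \<sigma> permutes {..<n}. Phi_free (free_mult p (permute_free \<sigma> q)))"
  using assms(1)
proof (induction rule: tuple_algebra_induct)
  case (single xs c)
  show ?case using assms(2)
  proof (induction rule: tuple_algebra_induct)
    case (single ys d)
    have "Phi_free (Poly_Mapping.single xs c) * Phi_free (Poly_Mapping.single ys d) =
        sB (c * d) (Phi sB n f xs * Phi sB n f ys)"
      by (simp add: B.scale_mult_left[symmetric] B.scale_mult_right)
    then show ?case
      using Phi_mult_Phi[OF \<open>length xs = n\<close> single]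
      by (simp add: free_mult_single B.scale_sum_right)
  qed (simp_all add: free_mult_right_simps permute_free_simps B.linear_extension_zero
      B.linear_extension_add distrib_left sum.distrib)
qed (simp_all add: free_mult_left_simps B.linear_extension_zero B.linear_extension_add
    distrib_right sum.distrib)

text \<open>Replacing \<open>permute_free \<sigma> q\<close> by \<open>q\<close> changes the product
  by an element of the ideal, which \<open>Phi_free\<close> kills. All \<open>n!\<close> summands
  therefore agree.\<close>

lemma Phi_free_mult_symmetric:
  assumes p: "p \<in> carrier (tuple_algebra n)" and q: "q \<in> carrier (tuple_algebra n)"
    and sym: "\<And>\<sigma>. \<sigma> permutes {..<n} \<Longrightarrow> permute_free \<sigma> q - q \<in> A.relations_span n"
  shows "Phi_free p * Phi_free q = sB (of_nat (fact n)) (Phi_free (free_mult p q))"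
proof -
  have "Phi_free (free_mult p (permute_free \<sigma> q)) = Phi_free (free_mult p q)"
    if "\<sigma> permutes {..<n}" for \<sigma>
  proof -
    have "free_mult p (permute_free \<sigma> q - q) \<in> A.relations_span n"
      by (rule A.free_mult_in_span[OF p sym[OF that]])
    from Phi_free_relations[OF this] show ?thesis
      by (simp add: module_hom.diff[OF module_hom_linearI[OF linear_free_mult_right]]
          B.linear_extension_diff)
  qed
  then show ?thesis
    by (simp add: Phi_free_mult[OF p q] B.sum_constant_scale card_permutations)
qed

text \<open>Invariance of the coset gives invariance of a representative modulo the relations, which
  suffices for the product formula.\<close>

lemma symmetric_tensorE:
  assumes "t \<in> carrier (symmetric_tensors sA n)"
  obtains p where "p \<in> carrier (tuple_algebra n)" "t = A.relations_span n +>\<^bsub>tuple_algebra n\<^esub> p"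
    "\<And>\<sigma>. \<sigma> permutes {..<n} \<Longrightarrow> permute_free \<sigma> p - p \<in> A.relations_span n"
proof -
  obtain p where p: "p \<in> carrier (tuple_algebra n)" "t = A.relations_span n +>\<^bsub>tuple_algebra n\<^esub> p"
    using assms by (auto simp: symmetric_tensors_def A.carrier_tensor_power)
  have "permute_free \<sigma> p - p \<in> A.relations_span n" if \<sigma>: "\<sigma> permutes {..<n}" for \<sigma>
  proof -
    have "(\<lambda>i. i + permute_free \<sigma> p) ` A.relations_span n = (\<lambda>i. i + p) ` A.relations_span n"
      using assms \<sigma> p A.permute_tensor_coset[OF \<sigma>, of p]
      by (auto simp: symmetric_tensors_def r_coset_tuple_algebra)
    \<comment> \<open>Since \<open>0\<close> is in the span, \<open>permute_free \<sigma> p\<close>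
      lies in its own coset, hence in that of \<open>p\<close>.\<close>
    moreover have "permute_free \<sigma> p \<in> (\<lambda>i. i + permute_free \<sigma> p) ` A.relations_span n"
      using free.span_zero by (intro image_eqI[of _ _ 0]) auto
    ultimately show ?thesis
      by auto
  qed
  with p that show ?thesis by blast
qed

text \<open>The product formula carries a factor \<open>n!\<close>, as does the value at the unit;
  the scalar \<open>c\<close>, an inverse of \<open>n!\<close>, corrects both.\<close>

lemma induced_Phi_ring_hom:
  assumes inv: "c * of_nat (fact n) = 1"
  shows "ring_hom_ring (symmetric_tensors sA n) type_ring
    (\<lambda>t. sB c (induced_map sB (Phi sB n f) t))" (is "ring_hom_ring ?S _ ?h")
proof (rule ring_hom_ringI)
  show "ring ?S" by (rule A.ring_symmetric_tensors)
  show "ring (type_ring :: 'c ring)" by (rule ring_type_ring)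
  show "?h t \<in> carrier type_ring" for t
    by (simp add: type_ring_def)
  have "?h \<one>\<^bsub>?S\<^esub> = sB c (Phi sB n f (replicate n 1))"
    by (simp add: symmetric_tensors_def A.one_tensor_power induced_map_coset)
  then show "?h \<one>\<^bsub>?S\<^esub> = \<one>\<^bsub>type_ring\<^esub>"
    using inv by (simp add: Phi_1 type_ring_def del: of_nat_fact)
  fix t u
  assume "t \<in> carrier ?S" "u \<in> carrier ?S"
  then obtain p q where p: "p \<in> carrier (tuple_algebra n)" "t = A.relations_span n +>\<^bsub>tuple_algebra n\<^esub> p"
    and q: "q \<in> carrier (tuple_algebra n)" "u = A.relations_span n +>\<^bsub>tuple_algebra n\<^esub> q"
    and sym: "\<And>\<sigma>. \<sigma> permutes {..<n} \<Longrightarrow> permute_free \<sigma> q - q \<in> A.relations_span n"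
    by (metis symmetric_tensorE)
  have "?h (t \<otimes>\<^bsub>?S\<^esub> u) = sB c (Phi_free (free_mult p q))"
    using p q by (simp add: symmetric_tensors_def A.coset_mult induced_map_coset)
  \<comment> \<open>Inserting \<open>c * n! = 1\<close> creates the second \<open>c\<close> required
    by the two factors and the \<open>n!\<close> required by the product formula.\<close>
  also have "\<dots> = sB c (sB c (sB (of_nat (fact n)) (Phi_free (free_mult p q))))"
    using inv by (simp del: of_nat_fact)
  also have "\<dots> = ?h t * ?h u"
    using Phi_free_mult_symmetric[OF p(1) q(1) sym] p q
    by (simp add: induced_map_coset B.scale_mult_left[symmetric] B.scale_mult_right del: of_nat_fact B.scale_scale)
  finally show "?h (t \<otimes>\<^bsub>?S\<^esub> u) = ?h t \<otimes>\<^bsub>type_ring\<^esub> ?h u"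
    by (simp add: type_ring_def)
  show "?h (t \<oplus>\<^bsub>?S\<^esub> u) = ?h t \<oplus>\<^bsub>type_ring\<^esub> ?h u"
    using p q by (simp add: symmetric_tensors_def A.coset_add induced_map_coset type_ring_def
        B.linear_extension_add B.scale_right_distrib)
qed

end

theorem theorem2p8:
  fixes sA :: "'k::field_char_0 \<Rightarrow> 'a::{comm_ring, comm_monoid_mult} \<Rightarrow> 'a"
    and sB :: "'k \<Rightarrow> 'b::{comm_ring, comm_monoid_mult} \<Rightarrow> 'b"
    and f :: "'a \<Rightarrow> 'b"
    and n :: nat
  assumes "comm_algebra sA"
    and "comm_algebra sB"
    and "n \<ge> 1"
    and "frobenius_hom sA sB n f"
  shows "ring_hom_ring (symmetric_tensors sA n) type_ring
    (\<lambda>t. sB (1 / fact n) (induced_map sB (Phi sB n f) t))"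
proof -
  interpret A: comm_algebra sA by fact
  interpret B: comm_algebra sB by fact
  interpret f: Vector_Spaces.linear sA sB f
    using assms(4) by (simp add: frobenius_hom_def)
  interpret frobenius sA sB f n
    by unfold_locales (use assms(4) in \<open>auto simp: frobenius_hom_def\<close>)
  show ?thesis
    \<comment> \<open>Characteristic zero makes \<open>fact n\<close> nonzero, so
      \<open>1 / fact n\<close> is its inverse.\<close>
    by (rule induced_Phi_ring_hom) simp
qed


end
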